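(* Let $X$ be a real Banach function space over $[-\pi,\pi]$ such that $1\in X_a$. Let $\{L_n\}_{n\in\mathbb{N}}$ be a sequence of positive bounded linear operators on $X_{2\pi}^S$ and let $A$ be a positive bounded linear operator on $X_{2\pi}^S$. Write $h_0(x)=1$, $h_1(x)=\cos x$, $h_2(x)=\sin x$ for $x\in\mathbb{R}$, and suppose: (1) $A(h_0)^2=A(h_1)^2+A(h_2)^2$ and $A(h_0)(t)>0$ for every $t\in[-\pi,\pi]$; (2) $\lim_{n\to\infty}L_n(g)=A(g)$ in $C_{2\pi}(\mathbb{R})$ for all $g\in\{h_0,h_1,h_2\}$. Then $\lim_{n\to\infty}L_n(f)=A(f)$ in $X$ for all $f\in X_{2\pi}^S$ if and only if $\sup_n\|L_n\|_{B(X_{2\pi}^S)}<\infty$.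
   Context: Work on $[-\pi,\pi]$ with the Borel $\sigma$-algebra $\mathcal{S}$ and Lebesgue measure $\mu$. Let $\mathcal{M}$ be the set of real-valued measurable functions on $[-\pi,\pi]$ (identified when equal a.e.) and $\mathcal{M}^+$ the non-negative ones. A map $\rho:\mathcal{M}^+\to[0,+\infty]$ is a function norm if for all $f,g,f_n\in\mathcal{M}^+$, $a\ge 0$, $E\in\mathcal{S}$: (i) $\rho(f)=0\iff f=0$ a.e., $\rho(af)=a\rho(f)$, $\rho(f+g)\le\rho(f)+\rho(g)$; (ii) $g\le f$ a.e. implies $\rho(g)\le\rho(f)$; (iii) $f_n\uparrow f$ a.e. implies $\rho(f_n)\uparrow\rho(f)$; (iv) $\mu(E)<\infty$ implies $\rho(\chi_E)<\infty$; (v) $\mu(E)<\infty$ implies there is $C_E>0$, depending only on $E$ and $\rho$, with $\int_E f\,d\mu\le C_E\rho(f)$. The Banach function space $X$ generated by $\rho$ is the space of $f\in\mathcal{M}$ with $\|f\|_X:=\rho(|f|)<\infty$. A function $f\in X$ has absolutely continuous norm if $\|f\chi_{E_n}\|_X\to0$ for every sequence $E_n\in\mathcal{S}$ with $E_n\to\emptyset$ a.e. (i.e. $\chi_{E_n}\to0$ a.e.); $X_a$ is the set of all such $f$. Here $1$ is the constant function. For $\delta>0$, $T_\delta f(x)=f(x+\delta)$ if $x+\delta\in[-\pi,\pi]$ and $T_\delta f(x)=0$ otherwise. $X^S=X^S[-\pi,\pi]$ is the closure in $X$ of $\{f\in X:\lim_{\delta\to0}\|T_\delta f-f\|_X=0\}$.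 $X_{2\pi}^S$ is the Banach space of all measurable functions $f$ on $\mathbb{R}$ with $f|_{[-\pi,\pi]}\in X^S[-\pi,\pi]$ and $f(x+2\pi)=f(x)$ for a.e. $x\in\mathbb{R}$, normed by the $X$-norm of $f|_{[-\pi,\pi]}$. $C_{2\pi}(\mathbb{R})$ is the space of continuous $2\pi$-periodic functions on $\mathbb{R}$ with the sup-norm; when $1\in X_a$ it is contained in $X_{2\pi}^S$. A linear operator $L$ on $X_{2\pi}^S$ is positive if $f\ge0$ a.e. implies $L(f)\ge0$ a.e. "$L_n(g)\to A(g)$ in $C_{2\pi}(\mathbb{R})$" means $L_n(g),A(g)\in C_{2\pi}(\mathbb{R})$ and the convergence is uniform. $\|\cdot\|_{B(X_{2\pi}^S)}$ is the operator norm on bounded linear operators on $X_{2\pi}^S$. *)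

theory Defs
  imports "HOL-Analysis.Analysis"
begin

section \<open>Banach function spaces\<close>

text \<open>
  Functions are not quotiented by a.e. equality: an element of a function space is represented by
  any of its representatives, and every notion below is invariant under changing a representative
  on a null set (for a function norm this follows from its monotonicity, which is required
  up to null sets). A function on a measure space \<open>M\<close> is a total function of which only the
  values on \<open>space M\<close> matter, so the restriction of a function on the line to an interval is
  represented by that function itself.
\<close>

definition nonneg_measurable :: "'a measure \<Rightarrow> ('a \<Rightarrow> real) set" where
  "nonneg_measurable M = {f \<in> borel_measurable M. AE x in M. 0 \<le> f x}"

definition function_norm :: "'a measure \<Rightarrow> (('a \<Rightarrow> real) \<Rightarrow> ennreal) \<Rightarrow> bool" where
  "function_norm M \<rho> \<longleftrightarrow>
     (\<forall>f \<in> nonneg_measurable M. \<rho> f = 0 \<longleftrightarrow> (AE x in M. f x = 0)) \<and>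
     (\<forall>f \<in> nonneg_measurable M. \<forall>a::real. a \<ge> 0 \<longrightarrow> \<rho> (\<lambda>x. a * f x) = ennreal a * \<rho> f) \<and>
     (\<forall>f \<in> nonneg_measurable M. \<forall>g \<in> nonneg_measurable M. \<rho> (\<lambda>x. f x + g x) \<le> \<rho> f + \<rho> g) \<and>
     (\<forall>f \<in> nonneg_measurable M. \<forall>g \<in> nonneg_measurable M.
        (AE x in M. g x \<le> f x) \<longrightarrow> \<rho> g \<le> \<rho> f) \<and>
     (\<forall>F f. (\<forall>n::nat. F n \<in> nonneg_measurable M) \<longrightarrow> f \<in> nonneg_measurable M \<longrightarrow>
        (AE x in M. incseq (\<lambda>n. F n x) \<and> (\<lambda>n. F n x) \<longlonglongrightarrow> f x) \<longrightarrow>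
        incseq (\<lambda>n. \<rho> (F n)) \<and> (\<lambda>n. \<rho> (F n)) \<longlonglongrightarrow> \<rho> f) \<and>
     (\<forall>E \<in> sets M. emeasure M E < \<infinity> \<longrightarrow> \<rho> (indicator E) < \<infinity>) \<and>
     (\<forall>E \<in> sets M. emeasure M E < \<infinity> \<longrightarrow>
        (\<exists>C::real. C > 0 \<and>
           (\<forall>f \<in> nonneg_measurable M. (\<integral>\<^sup>+x\<in>E. ennreal (f x) \<partial>M) \<le> ennreal C * \<rho> f)))"

text \<open>The norm takes the value \<open>\<infinity>\<close> exactly at the measurable functions outside the space.\<close>

definition bfs_norm :: "(('a \<Rightarrow> real) \<Rightarrow> ennreal) \<Rightarrow> ('a \<Rightarrow> real) \<Rightarrow> ennreal" where
  "bfs_norm \<rho> f = \<rho> (\<lambda>x. \<bar>f x\<bar>)"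

definition bfs :: "'a measure \<Rightarrow> (('a \<Rightarrow> real) \<Rightarrow> ennreal) \<Rightarrow> ('a \<Rightarrow> real) set" where
  "bfs M \<rho> = {f \<in> borel_measurable M. bfs_norm \<rho> f < \<infinity>}"

text \<open>The functions of absolutely continuous norm.\<close>

definition bfs_ac :: "'a measure \<Rightarrow> (('a \<Rightarrow> real) \<Rightarrow> ennreal) \<Rightarrow> ('a \<Rightarrow> real) set" where
  "bfs_ac M \<rho> = {f \<in> bfs M \<rho>. \<forall>E. (\<forall>n::nat. E n \<in> sets M) \<longrightarrow>
      (AE x in M. (\<lambda>n. indicator (E n) x :: real) \<longlonglongrightarrow> 0) \<longrightarrow>
      (\<lambda>n. bfs_norm \<rho> (\<lambda>x. f x * indicator (E n) x)) \<longlonglongrightarrow> 0}"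


section \<open>The translation-continuous part and its periodic version\<close>

abbreviation interval_measure_pi :: "real measure" where
  "interval_measure_pi \<equiv> restrict_space lborel {-pi..pi}"

definition translate :: "real \<Rightarrow> (real \<Rightarrow> real) \<Rightarrow> real \<Rightarrow> real" where
  "translate \<delta> f x = (if x + \<delta> \<in> {-pi..pi} then f (x + \<delta>) else 0)"

definition translation_continuous :: "((real \<Rightarrow> real) \<Rightarrow> ennreal) \<Rightarrow> (real \<Rightarrow> real) set" where
  "translation_continuous \<rho> = {f \<in> bfs interval_measure_pi \<rho>.
      ((\<lambda>\<delta>. bfs_norm \<rho> (\<lambda>x. translate \<delta> f x - f x)) \<longlongrightarrow> 0) (at_right 0)}"

text \<open>The closure of the preceding set in the norm of the space.\<close>

definition XS :: "((real \<Rightarrow> real) \<Rightarrow> ennreal) \<Rightarrow> (real \<Rightarrow> real) set" where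
  "XS \<rho> = {f \<in> bfs interval_measure_pi \<rho>.
      \<forall>\<epsilon>>0. \<exists>g \<in> translation_continuous \<rho>. bfs_norm \<rho> (\<lambda>x. f x - g x) < \<epsilon>}"

definition XS_2pi :: "((real \<Rightarrow> real) \<Rightarrow> ennreal) \<Rightarrow> (real \<Rightarrow> real) set" where
  "XS_2pi \<rho> = {f \<in> borel_measurable lborel.
      f \<in> XS \<rho> \<and> (AE x in lborel. f (x + 2 * pi) = f x)}"


section \<open>Continuous periodic functions\<close>

definition C_2pi :: "(real \<Rightarrow> real) set" where
  "C_2pi = {f. continuous_on UNIV f \<and> (\<forall>x. f (x + 2 * pi) = f x)}"

text \<open>
  A class of functions modulo a.e. equality belongs to the continuous periodic functions if it has
  a continuous periodic representative. That representative is then unique, and pointwise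
  statements about the class refer to it.
\<close>

definition in_C_2pi :: "(real \<Rightarrow> real) \<Rightarrow> bool" where
  "in_C_2pi f \<longleftrightarrow> (\<exists>g \<in> C_2pi. AE x in lborel. f x = g x)"

definition C_rep :: "(real \<Rightarrow> real) \<Rightarrow> real \<Rightarrow> real" where
  "C_rep f = (THE g. g \<in> C_2pi \<and> (AE x in lborel. f x = g x))"

lemma C_rep_eqI:
  assumes "g \<in> C_2pi" "AE x in lborel. f x = g x"
  shows "C_rep f = g"
  unfolding C_rep_def
proof (rule the_equality)
  fix k assume k: "k \<in> C_2pi \<and> (AE x in lborel. f x = k x)"
  define U where "U = {x. k x \<noteq> g x}"
  have "continuous_on UNIV k" "continuous_on UNIV g"
    using k assms(1) by (auto simp: C_2pi_def)
  hence U: "open U"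
    unfolding U_def by (rule open_Collect_neq)
  have "AE x in lborel. k x = g x"
    using assms(2) conjunct2[OF k] by eventually_elim simp
  hence "U \<in> null_sets lborel"
    using U by (subst AE_iff_null_sets) (auto simp: U_def)
  hence "negligible U"
    by (simp add: negligible_iff_null_sets null_sets_completionI)
  hence "U = {}"
    using U open_not_negligible by blast
  thus "k = g"
    by (auto simp: U_def)
qed (use assms in auto)

lemma C_rep_in_C_2pi: "in_C_2pi f \<Longrightarrow> C_rep f \<in> C_2pi"
  by (auto simp: in_C_2pi_def C_rep_eqI)

lemma AE_C_rep: "in_C_2pi f \<Longrightarrow> AE x in lborel. f x = C_rep f x"
  by (metis C_rep_eqI in_C_2pi_def)

definition tendsto_C_2pi :: "(nat \<Rightarrow> real \<Rightarrow> real) \<Rightarrow> (real \<Rightarrow> real) \<Rightarrow> bool" where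
  "tendsto_C_2pi F f \<longleftrightarrow> (\<forall>n. in_C_2pi (F n)) \<and> in_C_2pi f \<and>
     uniform_limit UNIV (\<lambda>n. C_rep (F n)) (C_rep f) sequentially"


section \<open>Operators on the periodic space\<close>

text \<open>An operator on classes is a map of representatives that respects a.e. equality.\<close>

definition bounded_operator ::
    "((real \<Rightarrow> real) \<Rightarrow> ennreal) \<Rightarrow> ((real \<Rightarrow> real) \<Rightarrow> (real \<Rightarrow> real)) \<Rightarrow> bool" where
  "bounded_operator \<rho> L \<longleftrightarrow>
     (\<forall>f \<in> XS_2pi \<rho>. L f \<in> XS_2pi \<rho>) \<and>
     (\<forall>f \<in> XS_2pi \<rho>. \<forall>g \<in> XS_2pi \<rho>.
        (AE x in lborel. f x = g x) \<longrightarrow> (AE x in lborel. L f x = L g x)) \<and>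
     (\<forall>f \<in> XS_2pi \<rho>. \<forall>g \<in> XS_2pi \<rho>. AE x in lborel. L (\<lambda>y. f y + g y) x = L f x + L g x) \<and>
     (\<forall>f \<in> XS_2pi \<rho>. \<forall>c::real. AE x in lborel. L (\<lambda>y. c * f y) x = c * L f x) \<and>
     (\<exists>C::real. \<forall>f \<in> XS_2pi \<rho>. bfs_norm \<rho> (L f) \<le> ennreal C * bfs_norm \<rho> f)"

definition positive_operator ::
    "((real \<Rightarrow> real) \<Rightarrow> ennreal) \<Rightarrow> ((real \<Rightarrow> real) \<Rightarrow> (real \<Rightarrow> real)) \<Rightarrow> bool" where
  "positive_operator \<rho> L \<longleftrightarrow>
     (\<forall>f \<in> XS_2pi \<rho>. (AE x in lborel. 0 \<le> f x) \<longrightarrow> (AE x in lborel. 0 \<le> L f x))"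

definition operator_norm ::
    "((real \<Rightarrow> real) \<Rightarrow> ennreal) \<Rightarrow> ((real \<Rightarrow> real) \<Rightarrow> (real \<Rightarrow> real)) \<Rightarrow> ennreal" where
  "operator_norm \<rho> L = (SUP f \<in> {f \<in> XS_2pi \<rho>. bfs_norm \<rho> f \<le> 1}. bfs_norm \<rho> (L f))"

end

theory Submission
  imports Defs
begin

text \<open>
  Sufficiency has two halves. First, \<open>C\<^sub>2\<^sub>\<pi>\<close> is dense in \<open>X\<^sup>S\<close>: if \<open>g\<close> is translation
  continuous, the Riemann sums of its Steklov mean over \<open>[0, \<delta>]\<close> are averages of translates of
  \<open>g\<close>, hence close to \<open>g\<close> in norm; since the norm dominates the \<open>L\<^sup>1\<close> norm, translation is also
  \<open>L\<^sup>1\<close>-continuous at \<open>g\<close>, so the sums converge to the mean in \<open>L\<^sup>1\<close> and almost everywhere along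
  a subsequence, and the Fatou property carries the estimate over to the mean, which is
  continuous. Because \<open>1\<close> has absolutely continuous norm, cutting off near \<open>\<plusminus>\<pi>\<close> makes it periodic.
  Second, for \<open>f\<close> in \<open>C\<^sub>2\<^sub>\<pi>\<close> the Korovkin bound
  \<open>\<bar>f y - f x\<bar> \<le> \<epsilon> + C (1 - cos (y - x))\<close> is fed into the operators, and at the point \<open>t\<close> one chooses
  \<open>x\<close> with \<open>cos x = A h\<^sub>1(t) / A h\<^sub>0(t)\<close> and \<open>sin x = A h\<^sub>2(t) / A h\<^sub>0(t)\<close>, so that the error term vanishes
  in the limit. Necessity is a uniform boundedness argument, for which positivity of the
  operators allows condensation of singularities with a series of nonnegative functions.
\<close>

section \<open>Banach function norms\<close>

locale banach_function_norm =
  fixes M :: "'a measure" and \<rho> :: "('a \<Rightarrow> real) \<Rightarrow> ennreal"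
  assumes function_norm: "function_norm M \<rho>"
begin

abbreviation N :: "('a \<Rightarrow> real) \<Rightarrow> ennreal" where
  "N \<equiv> bfs_norm \<rho>"

lemma abs_nonneg_measurable [simp]:
  "f \<in> borel_measurable M \<Longrightarrow> (\<lambda>x. \<bar>f x\<bar>) \<in> nonneg_measurable M"
  by (auto simp: nonneg_measurable_def)

lemma rho_mono:
  "f \<in> nonneg_measurable M \<Longrightarrow> g \<in> nonneg_measurable M \<Longrightarrow> AE x in M. g x \<le> f x \<Longrightarrow> \<rho> g \<le> \<rho> f"
  using function_norm unfolding function_norm_def by blast

lemma norm_mono:
  assumes "f \<in> borel_measurable M" "g \<in> borel_measurable M" "AE x in M. \<bar>g x\<bar> \<le> \<bar>f x\<bar>"
  shows "N g \<le> N f"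
  unfolding bfs_norm_def using assms by (intro rho_mono) auto

lemma norm_cong:
  assumes "f \<in> borel_measurable M" "g \<in> borel_measurable M" "AE x in M. g x = f x"
  shows "N g = N f"
  by (intro antisym norm_mono assms) (use assms(3) in auto)

lemma norm_eq_0_iff:
  "f \<in> borel_measurable M \<Longrightarrow> N f = 0 \<longleftrightarrow> (AE x in M. f x = 0)"
  using function_norm unfolding function_norm_def bfs_norm_def by fastforce

lemma norm_cmult:
  assumes "f \<in> borel_measurable M"
  shows "N (\<lambda>x. c * f x) = ennreal \<bar>c\<bar> * N f"
  using function_norm assms unfolding function_norm_def bfs_norm_def abs_mult by simp

lemma norm_minus_commute: "N (\<lambda>x. f x - g x) = N (\<lambda>x. g x - f x)"
  by (simp add: bfs_norm_def abs_minus_commute)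

lemma norm_add:
  assumes "f \<in> borel_measurable M" "g \<in> borel_measurable M"
  shows "N (\<lambda>x. f x + g x) \<le> N f + N g"
proof -
  have "(\<lambda>x. \<bar>f x\<bar> + \<bar>g x\<bar>) \<in> nonneg_measurable M"
    using assms by (auto simp: nonneg_measurable_def)
  hence "N (\<lambda>x. f x + g x) \<le> \<rho> (\<lambda>x. \<bar>f x\<bar> + \<bar>g x\<bar>)"
    unfolding bfs_norm_def using assms by (intro rho_mono) auto
  also have "\<dots> \<le> N f + N g"
    using function_norm assms unfolding function_norm_def bfs_norm_def by simp
  finally show ?thesis .
qed

lemma norm_triangle:
  assumes [measurable]: "f \<in> borel_measurable M" "g \<in> borel_measurable M" "h \<in> borel_measurable M"
  shows "N (\<lambda>x. f x - h x) \<le> N (\<lambda>x. f x - g x) + N (\<lambda>x. g x - h x)"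
  using norm_add[of "\<lambda>x. f x - g x" "\<lambda>x. g x - h x"] by simp

lemma norm_sum:
  assumes "finite I" "\<And>i. i \<in> I \<Longrightarrow> F i \<in> borel_measurable M"
  shows "N (\<lambda>x. \<Sum>i\<in>I. F i x) \<le> (\<Sum>i\<in>I. N (F i))"
  using assms
proof (induction I rule: finite_induct)
  case empty
  then show ?case by (simp add: norm_eq_0_iff)
next
  case (insert i I)
  have "N (\<lambda>x. F i x + (\<Sum>i\<in>I. F i x)) \<le> N (F i) + N (\<lambda>x. \<Sum>i\<in>I. F i x)"
    using insert by (intro norm_add) auto
  also have "\<dots> \<le> N (F i) + (\<Sum>i\<in>I. N (F i))"
    using insert by (intro add_left_mono) auto
  finally show ?case
    using insert by simp
qed

lemma norm_le_const:
  assumes "f \<in> borel_measurable M" "AE x in M. \<bar>f x\<bar> \<le> c" "0 \<le> c"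
  shows "N f \<le> ennreal c * N (\<lambda>x. 1)"
proof -
  have "N f \<le> N (\<lambda>x. c * 1)"
    using assms by (intro norm_mono) auto
  thus ?thesis
    using assms(3) by (subst (asm) norm_cmult) auto
qed

text \<open>Axiom (iii) is applied to the running infima of \<open>\<bar>F k x\<bar>\<close> over
  \<open>k \<ge> n\<close>. They increase to \<open>\<bar>f x\<bar>\<close> wherever
  \<open>F n x\<close> converges to \<open>f x\<close>, and the \<open>n\<close>-th one lies below
  \<open>\<bar>F n x\<bar>\<close>, so its norm is at most \<open>c\<close>.\<close>

lemma norm_fatou:
  assumes F [measurable]: "\<And>n. F n \<in> borel_measurable M" and f [measurable]: "f \<in> borel_measurable M"
    and lim: "AE x in M. (\<lambda>n. F n x) \<longlonglongrightarrow> f x" and le: "\<And>n. N (F n) \<le> c"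
  shows "N f \<le> c"
proof -
  define g where "g n x = (INF k\<in>{n..}. \<bar>F k x\<bar>)" for n x
  have bdd: "bdd_below ((\<lambda>k. \<bar>F k x\<bar>) ` A)" for x A
    by (auto intro: bdd_belowI[of _ 0])
  have g_meas: "g n \<in> borel_measurable M" for n
    unfolding g_def[abs_def] by (intro borel_measurable_cINF_real) auto
  have g_nonneg: "0 \<le> g n x" for n x
    unfolding g_def by (intro cINF_greatest) auto
  have g_le: "g n x \<le> \<bar>F n x\<bar>" for n x
    unfolding g_def by (intro cINF_lower bdd) auto
  have g_nm: "g n \<in> nonneg_measurable M" for n
    using g_meas g_nonneg by (auto simp: nonneg_measurable_def)
  have inc: "incseq (\<lambda>n. g n x)" for x
    unfolding g_def by (intro monoI cINF_superset_mono bdd) auto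
  have conv: "AE x in M. incseq (\<lambda>n. g n x) \<and> (\<lambda>n. g n x) \<longlonglongrightarrow> \<bar>f x\<bar>"
    using lim
  proof eventually_elim
    case (elim x)
    hence lim': "(\<lambda>n. \<bar>F n x\<bar>) \<longlonglongrightarrow> \<bar>f x\<bar>"
      by (rule tendsto_rabs)
    have "(\<lambda>n. g n x) \<longlonglongrightarrow> \<bar>f x\<bar>"
    proof (rule LIMSEQ_I)
      fix e :: real assume "0 < e"
      then obtain n0 where n0: "\<And>n. n \<ge> n0 \<Longrightarrow> norm (\<bar>F n x\<bar> - \<bar>f x\<bar>) < e / 2"
        using LIMSEQ_D[OF lim', of "e / 2"] by auto
      have "norm (g n x - \<bar>f x\<bar>) < e" if "n \<ge> n0" for n
      proof -
        have "\<bar>f x\<bar> - e / 2 \<le> g n x"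
          unfolding g_def 
        proof (rule cINF_greatest)
          fix k assume "k \<in> {n..}"
          hence "\<bar>\<bar>F k x\<bar> - \<bar>f x\<bar>\<bar> < e / 2"
            using n0[of k] that by auto
          thus "\<bar>f x\<bar> - e / 2 \<le> \<bar>F k x\<bar>"
            by linarith
        qed simp
        moreover have "g n x < \<bar>f x\<bar> + e / 2"
          using g_le[of n x] n0[OF that] unfolding real_norm_def by linarith
        ultimately show ?thesis
          using \<open>0 < e\<close> by auto
      qed
      thus "\<exists>n0. \<forall>n\<ge>n0. norm (g n x - \<bar>f x\<bar>) < e"
        by blast
    qed
    thus ?case using inc by blast
  qed
  have "(\<lambda>n. \<rho> (g n)) \<longlonglongrightarrow> \<rho> (\<lambda>x. \<bar>f x\<bar>)"
    using function_norm g_nm abs_nonneg_measurable[OF f] conv unfolding function_norm_def by blast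
  moreover have "\<rho> (g n) \<le> c" for n
  proof -
    have "\<rho> (g n) \<le> \<rho> (\<lambda>x. \<bar>F n x\<bar>)"
      using g_le by (intro rho_mono g_nm) auto
    thus ?thesis
      using le[of n] by (simp add: bfs_norm_def)
  qed
  ultimately show ?thesis
    unfolding bfs_norm_def by (intro LIMSEQ_le_const2) auto
qed

text \<open>Axiom (v) taken at the whole space. Through it, norm estimates yield statements about
  almost everywhere convergence.\<close>

lemma L1_bound:
  assumes "emeasure M (space M) < \<infinity>"
  obtains C :: real where "C > 0"
    "\<And>f. f \<in> borel_measurable M \<Longrightarrow> (\<integral>\<^sup>+x. ennreal \<bar>f x\<bar> \<partial>M) \<le> ennreal C * N f"
proof -
  obtain C :: real where C: "C > 0"
    "\<And>f. f \<in> nonneg_measurable M \<Longrightarrow> (\<integral>\<^sup>+x\<in>space M. ennreal (f x) \<partial>M) \<le> ennreal C * \<rho> f"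
    using function_norm assms unfolding function_norm_def by (meson sets.top)
  show thesis
  proof (rule that[OF C(1)])
    fix f :: "'a \<Rightarrow> real" assume "f \<in> borel_measurable M"
    hence "(\<integral>\<^sup>+x\<in>space M. ennreal \<bar>f x\<bar> \<partial>M) \<le> ennreal C * N f"
      unfolding bfs_norm_def by (intro C(2)) auto
    moreover have "(\<integral>\<^sup>+x\<in>space M. ennreal \<bar>f x\<bar> \<partial>M) = (\<integral>\<^sup>+x. ennreal \<bar>f x\<bar> \<partial>M)"
      by (intro nn_integral_cong) auto
    ultimately show "(\<integral>\<^sup>+x. ennreal \<bar>f x\<bar> \<partial>M) \<le> ennreal C * N f"
      by simp
  qed
qed

text \<open>The partial sums are bounded in
  \<open>L\<^sup>1\<close>, so the series converges absolutely almost everywhere, and the Fatou property turns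
  bounds of partial sums into bounds of tails.\<close>

lemma riesz_fischer:
  assumes fin: "emeasure M (space M) < \<infinity>"
    and F [measurable]: "\<And>k. F k \<in> borel_measurable M"
    and le: "\<And>k. N (F k) \<le> ennreal ((1/2) ^ k)"
  shows "AE x in M. summable (\<lambda>k. \<bar>F k x\<bar>)"
    and "N (\<lambda>x. (\<Sum>k. F k x) - (\<Sum>k<n. F k x)) \<le> ennreal (2 * (1/2) ^ n)"
proof -
  obtain C :: real where C: "C > 0"
    "\<And>f. f \<in> borel_measurable M \<Longrightarrow> (\<integral>\<^sup>+x. ennreal \<bar>f x\<bar> \<partial>M) \<le> ennreal C * N f"
    using L1_bound[OF fin] by blast
  have "(\<Sum>k. ennreal ((1/2) ^ k)) = ennreal (\<Sum>k. (1/2) ^ k)"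
    by (intro suminf_ennreal2) (auto intro: summable_geometric)
  hence geo: "(\<Sum>k. ennreal ((1/2) ^ k)) = 2"
    by (simp add: suminf_geometric)
  have "(\<integral>\<^sup>+x. (\<Sum>k. ennreal \<bar>F k x\<bar>) \<partial>M) = (\<Sum>k. \<integral>\<^sup>+x. ennreal \<bar>F k x\<bar> \<partial>M)"
    by (intro nn_integral_suminf) auto
  also have "\<dots> \<le> (\<Sum>k. ennreal C * ennreal ((1/2) ^ k))"
    by (intro suminf_le summableI order_trans[OF C(2)] mult_left_mono le) auto
  also have "\<dots> = ennreal C * 2"
    using geo by simp
  also have "\<dots> < \<infinity>"
    by (simp add: ennreal_mult_less_top)
  finally have "AE x in M. (\<Sum>k. ennreal \<bar>F k x\<bar>) \<noteq> \<infinity>"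
    by (intro nn_integral_PInf_AE) auto
  thus summ: "AE x in M. summable (\<lambda>k. \<bar>F k x\<bar>)"
    by eventually_elim (auto intro!: summable_suminf_not_top)
  have "N (\<lambda>x. (\<Sum>k<m + n. F k x) - (\<Sum>k<n. F k x)) \<le> ennreal (2 * (1/2) ^ n)" for m
  proof -
    have eq: "(\<Sum>k<m + n. F k x) - (\<Sum>k<n. F k x) = (\<Sum>k<m. F (k + n) x)" for x
      by (induction m) auto
    have "N (\<lambda>x. \<Sum>k<m. F (k + n) x) \<le> (\<Sum>k<m. N (F (k + n)))"
      by (intro norm_sum) auto
    also have "\<dots> \<le> (\<Sum>k<m. ennreal ((1/2) ^ (k + n)))"
      by (intro sum_mono le)
    also have "\<dots> = ennreal ((\<Sum>k<m. (1/2) ^ k) * (1/2) ^ n)"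
      by (simp add: power_add sum_distrib_right)
    also have "\<dots> \<le> ennreal (2 * (1/2) ^ n)"
      using sum_le_suminf[of "\<lambda>k. (1/2::real) ^ k" "{..<m}"]
      by (intro ennreal_leI mult_right_mono) (auto simp: suminf_geometric summable_geometric)
    finally show ?thesis
      by (simp add: eq)
  qed
  thus "N (\<lambda>x. (\<Sum>k. F k x) - (\<Sum>k<n. F k x)) \<le> ennreal (2 * (1/2) ^ n)"
  proof (rule norm_fatou[rotated 3])
    show "AE x in M. (\<lambda>m. (\<Sum>k<m + n. F k x) - (\<Sum>k<n. F k x)) \<longlonglongrightarrow>
             (\<Sum>k. F k x) - (\<Sum>k<n. F k x)"
      using summ
    proof eventually_elim
      case (elim x)
      hence "(\<lambda>m. \<Sum>k<m. F k x) \<longlonglongrightarrow> (\<Sum>k. F k x)"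
        by (intro summable_LIMSEQ) (rule summable_rabs_cancel)
      hence "(\<lambda>m. \<Sum>k<m + n. F k x) \<longlonglongrightarrow> (\<Sum>k. F k x)"
        by (rule LIMSEQ_ignore_initial_segment)
      thus ?case by (intro tendsto_intros)
    qed
  qed auto
qed

end

section \<open>The translation-continuous part as a vector lattice\<close>

abbreviation (input) "Mpi \<equiv> interval_measure_pi"

lemma space_Mpi [simp]: "space Mpi = {-pi..pi}"
  by (simp add: space_restrict_space)

lemma emeasure_Mpi_finite: "emeasure Mpi (space Mpi) < \<infinity>"
  by (simp add: emeasure_restrict_space)

lemma sets_Mpi_iff: "A \<in> sets Mpi \<longleftrightarrow> A \<subseteq> {-pi..pi} \<and> A \<in> sets borel"
  by (subst sets_restrict_space_iff) auto

lemma AE_Mpi_iff: "(AE x in Mpi. P x) \<longleftrightarrow> (AE x in lborel. x \<in> {-pi..pi} \<longrightarrow> P x)"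
  by (intro AE_restrict_space_iff) auto

lemma AE_Mpi_I: "AE x in lborel. P x \<Longrightarrow> AE x in Mpi. P x"
  by (subst AE_Mpi_iff) auto

lemma borel_measurable_Mpi_iff:
  "f \<in> borel_measurable Mpi \<longleftrightarrow> (\<lambda>x. indicator {-pi..pi} x * f x :: real) \<in> borel_measurable borel"
  by (subst borel_measurable_restrict_space_iff) auto

lemma borel_imp_Mpi_measurable:
  "f \<in> borel_measurable borel \<Longrightarrow> f \<in> borel_measurable Mpi"
  by (intro measurable_restrict_space1) auto

lemma translate_eq: "translate \<delta> f x = indicator {-pi..pi} (x + \<delta>) * f (x + \<delta>)"
  by (auto simp: translate_def indicator_def)

text \<open>A translate reads \<open>f\<close> only inside the interval and is \<open>0\<close>
  elsewhere, so measurability on the interval alone makes it Borel on the whole line.\<close>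

lemma translate_measurable_borel [measurable]:
  assumes "f \<in> borel_measurable Mpi"
  shows "translate \<delta> f \<in> borel_measurable borel"
proof -
  have "(\<lambda>x. (\<lambda>y. indicator {-pi..pi} y * f y) (x + \<delta>)) \<in> borel_measurable borel"
    using assms unfolding borel_measurable_Mpi_iff by measurable
  thus ?thesis
    by (simp add: translate_eq[abs_def])
qed

lemma translate_measurable [measurable]:
  "f \<in> borel_measurable Mpi \<Longrightarrow> translate \<delta> f \<in> borel_measurable Mpi"
  by (rule borel_imp_Mpi_measurable) (rule translate_measurable_borel)

lemma ennreal_half_plus_half: "(a :: ennreal) / 2 + a / 2 = a"
proof (cases a rule: ennreal_cases)
  case (real r)
  hence "a / 2 = ennreal (r / 2)"
    by (metis divide_ennreal ennreal_numeral zero_less_numeral)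
  thus ?thesis
    using real by (simp flip: ennreal_plus)
qed (simp add: ennreal_top_divide)

lemma ennreal_less_divide_imp_mult_less:
  assumes "x < a / ennreal r" "0 < r"
  shows "ennreal r * x < a"
proof (cases a rule: ennreal_cases)
  case (real s)
  with assms have "x < ennreal (s / r)"
    by (simp add: divide_ennreal)
  then obtain t where "x = ennreal t" "0 \<le> t" "t < s / r"
    by (cases x rule: ennreal_cases) (auto simp: ennreal_less_iff)
  thus ?thesis
    using real assms by (simp add: ennreal_less_iff field_simps flip: ennreal_mult)
next
  case top
  thus ?thesis
    using assms by (simp add: ennreal_mult_less_top ennreal_top_divide)
qed

section \<open>Lattice operations and norm closure for the translation-continuous part\<close>

locale pi_function_norm = banach_function_norm interval_measure_pi \<rho> for \<rho>
begin

lemma bfs_iff: "f \<in> bfs Mpi \<rho> \<longleftrightarrow> f \<in> borel_measurable Mpi \<and> N f < \<infinity>"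
  by (auto simp: bfs_def)

lemma tc_measurable: "f \<in> translation_continuous \<rho> \<Longrightarrow> f \<in> borel_measurable Mpi"
  by (auto simp: translation_continuous_def bfs_def)

lemma XS_measurable: "f \<in> XS \<rho> \<Longrightarrow> f \<in> borel_measurable Mpi"
  by (auto simp: XS_def bfs_def)

lemma XS_2pi_measurable:
  "f \<in> XS_2pi \<rho> \<Longrightarrow> f \<in> borel_measurable borel" "f \<in> XS_2pi \<rho> \<Longrightarrow> f \<in> borel_measurable Mpi"
  by (auto simp: XS_2pi_def XS_measurable)

lemma XS_2pi_finite: "f \<in> XS_2pi \<rho> \<Longrightarrow> N f < \<infinity>"
  by (auto simp: XS_2pi_def XS_def bfs_def)

lemma bfs_add:
  assumes "f \<in> bfs Mpi \<rho>" "g \<in> bfs Mpi \<rho>"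
  shows "(\<lambda>x. f x + g x) \<in> bfs Mpi \<rho>"
proof -
  have "N f + N g < \<infinity>"
    using assms by (auto simp: bfs_iff)
  with norm_add[of f g] show ?thesis
    using assms by (auto simp: bfs_iff intro: le_less_trans)
qed

lemma bfs_cmult: "f \<in> bfs Mpi \<rho> \<Longrightarrow> (\<lambda>x. c * f x) \<in> bfs Mpi \<rho>"
  by (auto simp: bfs_iff norm_cmult ennreal_mult_less_top)

lemma bfs_abs: "f \<in> bfs Mpi \<rho> \<Longrightarrow> (\<lambda>x. \<bar>f x\<bar>) \<in> bfs Mpi \<rho>"
  by (auto simp: bfs_iff bfs_norm_def)

lemma tc_add:
  assumes f: "f \<in> translation_continuous \<rho>" and g: "g \<in> translation_continuous \<rho>"
  shows "(\<lambda>x. f x + g x) \<in> translation_continuous \<rho>"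
proof -
  note [measurable] = tc_measurable[OF f] tc_measurable[OF g]
  define w where "w h \<delta> = N (\<lambda>x. translate \<delta> h x - h x)" for h \<delta>
  have "((\<lambda>\<delta>. w (\<lambda>x. f x + g x) \<delta>) \<longlongrightarrow> 0) (at_right 0)"
  proof (rule tendsto_sandwich[where f = "\<lambda>_. 0"])
    have "w (\<lambda>x. f x + g x) \<delta> \<le> w f \<delta> + w g \<delta>" for \<delta>
    proof -
      have "w (\<lambda>x. f x + g x) \<delta> = N (\<lambda>x. (translate \<delta> f x - f x) + (translate \<delta> g x - g x))"
        by (simp add: w_def translate_eq algebra_simps)
      also have "\<dots> \<le> w f \<delta> + w g \<delta>"
        unfolding w_def by (intro norm_add) auto
      finally show ?thesis .
    qed
    thus "\<forall>\<^sub>F \<delta> in at_right 0. w (\<lambda>x. f x + g x) \<delta> \<le> w f \<delta> + w g \<delta>"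
      by simp
    have "((\<lambda>\<delta>. w f \<delta> + w g \<delta>) \<longlongrightarrow> 0 + 0) (at_right 0)"
      using f g by (intro tendsto_add) (auto simp: translation_continuous_def w_def)
    thus "((\<lambda>\<delta>. w f \<delta> + w g \<delta>) \<longlongrightarrow> 0) (at_right 0)"
      by simp
  qed auto
  thus ?thesis
    using f g bfs_add by (auto simp: translation_continuous_def w_def)
qed

lemma tc_cmult:
  assumes f: "f \<in> translation_continuous \<rho>"
  shows "(\<lambda>x. c * f x) \<in> translation_continuous \<rho>"
proof -
  note [measurable] = tc_measurable[OF f]
  have eq: "N (\<lambda>x. translate \<delta> (\<lambda>x. c * f x) x - c * f x) = ennreal \<bar>c\<bar> * N (\<lambda>x. translate \<delta> f x - f x)" for \<delta>
  proof -
    have "N (\<lambda>x. translate \<delta> (\<lambda>x. c * f x) x - c * f x) = N (\<lambda>x. c * (translate \<delta> f x - f x))"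
      by (simp add: translate_eq algebra_simps)
    thus ?thesis
      by (simp add: norm_cmult)
  qed
  have "((\<lambda>\<delta>. ennreal \<bar>c\<bar> * N (\<lambda>x. translate \<delta> f x - f x)) \<longlongrightarrow> ennreal \<bar>c\<bar> * 0) (at_right 0)"
    using f by (intro ennreal_tendsto_cmult) (auto simp: translation_continuous_def)
  thus ?thesis
    using f bfs_cmult by (auto simp: translation_continuous_def eq)
qed

text \<open>Translation commutes with the absolute value, also where it inserts \<open>0\<close>, so
  the reverse triangle inequality bounds the modulus of continuity.\<close>

lemma tc_abs:
  assumes f: "f \<in> translation_continuous \<rho>"
  shows "(\<lambda>x. \<bar>f x\<bar>) \<in> translation_continuous \<rho>"
proof -
  note [measurable] = tc_measurable[OF f]
  have "((\<lambda>\<delta>. N (\<lambda>x. translate \<delta> (\<lambda>x. \<bar>f x\<bar>) x - \<bar>f x\<bar>)) \<longlongrightarrow> 0) (at_right 0)"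
  proof (rule tendsto_sandwich[where f = "\<lambda>_. 0"])
    show "((\<lambda>\<delta>. N (\<lambda>x. translate \<delta> f x - f x)) \<longlongrightarrow> 0) (at_right 0)"
      using f by (auto simp: translation_continuous_def)
    have "N (\<lambda>x. translate \<delta> (\<lambda>x. \<bar>f x\<bar>) x - \<bar>f x\<bar>) \<le> N (\<lambda>x. translate \<delta> f x - f x)" for \<delta>
    proof (intro norm_mono AE_I2)
      have "translate \<delta> (\<lambda>x. \<bar>f x\<bar>) \<in> borel_measurable Mpi"
        by (intro translate_measurable) measurable
      thus "(\<lambda>x. translate \<delta> (\<lambda>x. \<bar>f x\<bar>) x - \<bar>f x\<bar>) \<in> borel_measurable Mpi"
        by measurable
      show "(\<lambda>x. translate \<delta> f x - f x) \<in> borel_measurable Mpi"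
        by measurable
    qed (auto simp: translate_def)
    thus "\<forall>\<^sub>F \<delta> in at_right 0. N (\<lambda>x. translate \<delta> (\<lambda>x. \<bar>f x\<bar>) x - \<bar>f x\<bar>) \<le> N (\<lambda>x. translate \<delta> f x - f x)"
      by simp
  qed auto
  thus ?thesis
    using f bfs_abs by (auto simp: translation_continuous_def)
qed

lemma tc_subset_XS: "translation_continuous \<rho> \<subseteq> XS \<rho>"
proof
  fix f assume f: "f \<in> translation_continuous \<rho>"
  have "N (\<lambda>x. f x - f x) = 0"
    by (simp add: norm_eq_0_iff)
  with f show "f \<in> XS \<rho>"
    unfolding XS_def by (auto simp: translation_continuous_def intro!: bexI[of _ f])
qed

text \<open>A closure is closed: half of the tolerance is spent on each of two approximations.
  Finiteness of the norm of \<open>f\<close> is derived rather than assumed, which spares a separate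
  check in every later use.\<close>

lemma XS_closed:
  assumes f: "f \<in> borel_measurable Mpi"
    and approx: "\<And>\<epsilon>. \<epsilon> > 0 \<Longrightarrow> \<exists>g \<in> XS \<rho>. N (\<lambda>x. f x - g x) < \<epsilon>"
  shows "f \<in> XS \<rho>"
proof -
  have *: "\<exists>g \<in> translation_continuous \<rho>. N (\<lambda>x. f x - g x) < \<epsilon>" if "\<epsilon> > 0" for \<epsilon>
  proof -
    have e2: "\<epsilon> / 2 > 0" using that by (simp add: ennreal_zero_less_divide)
    obtain g where g: "g \<in> XS \<rho>" "N (\<lambda>x. f x - g x) < \<epsilon> / 2"
      using approx[OF e2] by blast
    obtain h where h: "h \<in> translation_continuous \<rho>" "N (\<lambda>x. g x - h x) < \<epsilon> / 2"
      using g(1) e2 by (auto simp: XS_def)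
    have "N (\<lambda>x. f x - h x) \<le> N (\<lambda>x. f x - g x) + N (\<lambda>x. g x - h x)"
      by (intro norm_triangle f XS_measurable[OF g(1)] tc_measurable[OF h(1)])
    also have "\<dots> < \<epsilon> / 2 + \<epsilon> / 2"
      using g(2) h(2) by (intro add_strict_mono)
    also have "\<dots> = \<epsilon>"
      by (simp add: ennreal_half_plus_half)
    finally show ?thesis using h(1) by blast
  qed
  \<comment> \<open>A single approximant at distance below \<open>1\<close> gives finiteness of the
    norm of \<open>f\<close>.\<close>
  obtain g where g: "g \<in> translation_continuous \<rho>" "N (\<lambda>x. f x - g x) < 1"
    using *[of 1] by auto
  have "N (\<lambda>x. (f x - g x) + g x) \<le> N (\<lambda>x. f x - g x) + N g"
    using tc_measurable[OF g(1)] f by (intro norm_add) auto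
  also have "\<dots> < \<infinity>"
    using g by (auto simp: translation_continuous_def bfs_def intro: less_trans)
  finally show ?thesis
    using f * by (simp add: XS_def bfs_iff)
qed

lemma XS_add:
  assumes f: "f \<in> XS \<rho>" and g: "g \<in> XS \<rho>"
  shows "(\<lambda>x. f x + g x) \<in> XS \<rho>"
proof (rule XS_closed)
  note [measurable] = XS_measurable[OF f] XS_measurable[OF g]
  show "(\<lambda>x. f x + g x) \<in> borel_measurable Mpi" by measurable
  fix \<epsilon> :: ennreal assume "\<epsilon> > 0"
  hence "\<epsilon> / 2 > 0" by (simp add: ennreal_zero_less_divide)
  then obtain f' g' where f': "f' \<in> translation_continuous \<rho>" "N (\<lambda>x. f x - f' x) < \<epsilon> / 2"
    and g': "g' \<in> translation_continuous \<rho>" "N (\<lambda>x. g x - g' x) < \<epsilon> / 2"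
    using f g unfolding XS_def by blast
  note [measurable] = tc_measurable[OF f'(1)] tc_measurable[OF g'(1)]
  have "N (\<lambda>x. (f x + g x) - (f' x + g' x)) = N (\<lambda>x. (f x - f' x) + (g x - g' x))"
    by (simp add: algebra_simps)
  also have "\<dots> \<le> N (\<lambda>x. f x - f' x) + N (\<lambda>x. g x - g' x)"
    by (intro norm_add) auto
  also have "\<dots> < \<epsilon> / 2 + \<epsilon> / 2"
    using f' g' by (intro add_strict_mono)
  also have "\<dots> = \<epsilon>"
    by (simp add: ennreal_half_plus_half)
  finally show "\<exists>h\<in>XS \<rho>. N (\<lambda>x. f x + g x - h x) < \<epsilon>"
    by (rule bexI[OF _ subsetD[OF tc_subset_XS tc_add[OF f'(1) g'(1)]]])
qed

lemma XS_cmult: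
  assumes f: "f \<in> XS \<rho>"
  shows "(\<lambda>x. c * f x) \<in> XS \<rho>"
proof (rule XS_closed)
  note [measurable] = XS_measurable[OF f]
  show "(\<lambda>x. c * f x) \<in> borel_measurable Mpi" by measurable
  fix \<epsilon> :: ennreal assume "\<epsilon> > 0"
  \<comment> \<open>The summand \<open>1\<close> keeps the divisor positive when
    \<open>c = 0\<close>.\<close>
  hence "\<epsilon> / ennreal (\<bar>c\<bar> + 1) > 0" by (simp add: ennreal_zero_less_divide)
  then obtain f' where f': "f' \<in> translation_continuous \<rho>"
      "N (\<lambda>x. f x - f' x) < \<epsilon> / ennreal (\<bar>c\<bar> + 1)"
    using f unfolding XS_def by blast
  note [measurable] = tc_measurable[OF f'(1)]
  have "N (\<lambda>x. c * f x - c * f' x) = ennreal \<bar>c\<bar> * N (\<lambda>x. f x - f' x)"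
    using norm_cmult[of "\<lambda>x. f x - f' x" c] by (simp add: algebra_simps)
  also have "\<dots> \<le> ennreal (\<bar>c\<bar> + 1) * N (\<lambda>x. f x - f' x)"
    by (intro mult_right_mono ennreal_leI) auto
  also have "\<dots> < \<epsilon>"
    using f'(2) by (intro ennreal_less_divide_imp_mult_less) auto
  finally show "\<exists>h\<in>XS \<rho>. N (\<lambda>x. c * f x - h x) < \<epsilon>"
    by (rule bexI[OF _ subsetD[OF tc_subset_XS tc_cmult[OF f'(1)]]])
qed

lemma XS_abs:
  assumes f: "f \<in> XS \<rho>"
  shows "(\<lambda>x. \<bar>f x\<bar>) \<in> XS \<rho>"
proof (rule XS_closed)
  note [measurable] = XS_measurable[OF f]
  show "(\<lambda>x. \<bar>f x\<bar>) \<in> borel_measurable Mpi" by measurable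
  fix \<epsilon> :: ennreal assume "\<epsilon> > 0"
  then obtain f' where f': "f' \<in> translation_continuous \<rho>" "N (\<lambda>x. f x - f' x) < \<epsilon>"
    using f unfolding XS_def by blast
  note [measurable] = tc_measurable[OF f'(1)]
  have "N (\<lambda>x. \<bar>f x\<bar> - \<bar>f' x\<bar>) \<le> N (\<lambda>x. f x - f' x)"
    by (intro norm_mono AE_I2) auto
  also note f'(2)
  finally show "\<exists>h\<in>XS \<rho>. N (\<lambda>x. \<bar>f x\<bar> - h x) < \<epsilon>"
    by (rule bexI[OF _ subsetD[OF tc_subset_XS tc_abs[OF f'(1)]]])
qed

section \<open>The periodic space as a vector lattice, closed under rapidly convergent
  series\<close>

lemma XS_2pi_add:
  assumes "f \<in> XS_2pi \<rho>" "g \<in> XS_2pi \<rho>"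
  shows "(\<lambda>x. f x + g x) \<in> XS_2pi \<rho>"
proof -
  have "AE x in lborel. f (x + 2 * pi) = f x" "AE x in lborel. g (x + 2 * pi) = g x"
    using assms by (auto simp: XS_2pi_def)
  hence "AE x in lborel. f (x + 2 * pi) + g (x + 2 * pi) = f x + g x"
    by eventually_elim simp
  thus ?thesis
    using assms by (auto simp: XS_2pi_def XS_add)
qed

lemma XS_2pi_cmult: "f \<in> XS_2pi \<rho> \<Longrightarrow> (\<lambda>x. c * f x) \<in> XS_2pi \<rho>"
  by (auto simp: XS_2pi_def XS_cmult)

lemma XS_2pi_diff:
  "f \<in> XS_2pi \<rho> \<Longrightarrow> g \<in> XS_2pi \<rho> \<Longrightarrow> (\<lambda>x. f x - g x) \<in> XS_2pi \<rho>"
  using XS_2pi_add[of f "\<lambda>x. (-1) * g x"] XS_2pi_cmult[of g "-1"] by simp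

lemma XS_2pi_abs:
  assumes "f \<in> XS_2pi \<rho>"
  shows "(\<lambda>x. \<bar>f x\<bar>) \<in> XS_2pi \<rho>"
proof -
  have "AE x in lborel. f (x + 2 * pi) = f x"
    using assms by (auto simp: XS_2pi_def)
  hence "AE x in lborel. \<bar>f (x + 2 * pi)\<bar> = \<bar>f x\<bar>"
    by eventually_elim simp
  thus ?thesis
    using assms by (auto simp: XS_2pi_def XS_abs)
qed

lemma XS_2pi_zero: "(\<lambda>x. 0) \<in> XS_2pi \<rho>"
proof -
  have z: "N (\<lambda>x. 0) = 0"
    by (simp add: norm_eq_0_iff)
  hence "(\<lambda>x. 0) \<in> translation_continuous \<rho>"
    by (simp add: translation_continuous_def bfs_iff translate_def)
  thus ?thesis
    using tc_subset_XS by (auto simp: XS_2pi_def)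
qed

lemma XS_2pi_sum:
  "finite I \<Longrightarrow> (\<And>i. i \<in> I \<Longrightarrow> F i \<in> XS_2pi \<rho>) \<Longrightarrow> (\<lambda>x. \<Sum>i\<in>I. F i x) \<in> XS_2pi \<rho>"
  by (induction I rule: finite_induct) (auto intro: XS_2pi_zero XS_2pi_add)

text \<open>The tail bound from \<open>riesz_fischer\<close> makes the partial sums approximants for
  \<open>XS_closed\<close>. This is the form of completeness that the condensation of singularities
  needs.\<close>

lemma XS_2pi_suminf:
  assumes F: "\<And>k. F k \<in> XS_2pi \<rho>" and le: "\<And>k. N (F k) \<le> ennreal ((1/2) ^ k)"
  shows "(\<lambda>x. \<Sum>k. F k x) \<in> XS_2pi \<rho>"
proof -
  note [measurable] = XS_2pi_measurable[OF F]
  have "AE x in lborel. \<forall>k. F k (x + 2 * pi) = F k x"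
    using F by (subst AE_all_countable) (auto simp: XS_2pi_def)
  hence "AE x in lborel. (\<Sum>k. F k (x + 2 * pi)) = (\<Sum>k. F k x)"
    by eventually_elim simp
  moreover have "(\<lambda>x. \<Sum>k. F k x) \<in> XS \<rho>"
  proof (rule XS_closed)
    fix \<epsilon> :: ennreal assume \<epsilon>: "\<epsilon> > 0"
    have "(\<lambda>n. ennreal (2 * (1/2) ^ n)) \<longlonglongrightarrow> ennreal (2 * 0)"
      by (intro tendsto_ennrealI tendsto_mult tendsto_const LIMSEQ_power_zero) auto
    hence "\<forall>\<^sub>F n in sequentially. ennreal (2 * (1/2) ^ n) < \<epsilon>"
      using \<epsilon> by (intro order_tendstoD(2)) auto
    then obtain n where "ennreal (2 * (1/2) ^ n) < \<epsilon>"
      by (auto simp: eventually_sequentially)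
    hence "N (\<lambda>x. (\<Sum>k. F k x) - (\<Sum>k<n. F k x)) < \<epsilon>"
      using riesz_fischer(2)[OF emeasure_Mpi_finite _ le, of n] by (auto intro: le_less_trans)
    moreover have "(\<lambda>x. \<Sum>k<n. F k x) \<in> XS \<rho>"
      using XS_2pi_sum[of "{..<n}" F] F by (auto simp: XS_2pi_def)
    ultimately show "\<exists>g\<in>XS \<rho>. N (\<lambda>x. (\<Sum>k. F k x) - g x) < \<epsilon>"
      by (intro bexI[of _ "\<lambda>x. \<Sum>k<n. F k x"])
  qed auto
  ultimately show ?thesis
    by (auto simp: XS_2pi_def)
qed

end

section \<open>Steklov means and density of the continuous periodic functions\<close>

text \<open>Dominated convergence with majorant \<open>\<bar>G\<bar>\<close>. The indicators of
  \<open>{..u n}\<close> converge at every \<open>t\<close> except possibly at the limit point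
  \<open>y\<close>, a null set.\<close>

lemma continuous_on_integral_atMost:
  fixes G :: "real \<Rightarrow> real"
  assumes G: "integrable lborel G"
  shows "continuous_on UNIV (\<lambda>y. LINT t|lborel. indicator {..y} t * G t)"
proof (rule continuous_at_imp_continuous_on, intro ballI)
  fix y :: real
  note [measurable] = borel_measurable_integrable[OF G]
  show "isCont (\<lambda>y. LINT t|lborel. indicator {..y} t * G t) y"
    unfolding continuous_at_sequentially comp_def
  proof (intro allI impI)
    fix u assume u: "u \<longlonglongrightarrow> y"
    show "(\<lambda>n. LINT t|lborel. indicator {..u n} t * G t) \<longlonglongrightarrow> (LINT t|lborel. indicator {..y} t * G t)"
    proof (rule integral_dominated_convergence[where w = "\<lambda>t. \<bar>G t\<bar>"])
      show "AE t in lborel. (\<lambda>n. indicator {..u n} t * G t) \<longlonglongrightarrow> indicator {..y} t * G t"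
        using AE_lborel_singleton[of y]
      proof eventually_elim
        case (elim t)
        have "\<forall>\<^sub>F n in sequentially. indicator {..u n} t * G t = indicator {..y} t * G t"
        proof (cases "t < y")
          case True
          hence "\<forall>\<^sub>F n in sequentially. t < u n"
            by (rule order_tendstoD(1)[OF u])
          thus ?thesis
            by eventually_elim (use True in auto)
        next
          case False
          hence "\<forall>\<^sub>F n in sequentially. u n < t"
            using u elim by (intro order_tendstoD(2)[of u y]) auto
          thus ?thesis
            by eventually_elim (use False elim in auto)
        qed
        thus ?case
          by (rule tendsto_eventually)
      qed
    qed (use G in \<open>auto simp: indicator_def\<close>)
  qed
qed

text \<open>Both terms are integrals over the cell \<open>{y - h<..y}\<close>, one of the constant
  \<open>G y\<close> and one of \<open>G\<close>, so the integrand of the difference is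
  \<open>G y - G t\<close>. Writing it with the displacement \<open>r = y - t\<close> prepares for
  exchanging the order of integration.\<close>

lemma riemann_cell_error:
  fixes G :: "real \<Rightarrow> real"
  assumes G: "integrable lborel G" and "0 \<le> h"
  defines "\<Phi> \<equiv> \<lambda>y. LINT t|lborel. indicator {..y} t * G t"
  shows "ennreal \<bar>h * G y - (\<Phi> y - \<Phi> (y - h))\<bar> \<le>
           (\<integral>\<^sup>+r. ennreal \<bar>G y - G (y - r)\<bar> * indicator {0..<h} r \<partial>lborel)"
proof -
  note [measurable] = borel_measurable_integrable[OF G]
  have int: "integrable lborel (\<lambda>t. indicator A t * G t)" if "A \<in> sets borel" for A
    using integrable_mult_indicator[of A lborel G] G that by simp
  have int_const: "integrable lborel (\<lambda>t. indicator {y - h<..y} t * G y)"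
    using \<open>0 \<le> h\<close> by (intro integrable_mult_left) (auto simp: emeasure_lborel_Ioc)
  have "\<Phi> y - \<Phi> (y - h) = (LINT t|lborel. indicator {..y} t * G t - indicator {..y - h} t * G t)"
    unfolding \<Phi>_def by (intro Bochner_Integration.integral_diff[symmetric] int) auto
  also have "\<dots> = (LINT t|lborel. indicator {y - h<..y} t * G t)"
    using \<open>0 \<le> h\<close> by (intro Bochner_Integration.integral_cong) (auto simp: indicator_def)
  finally have "h * G y - (\<Phi> y - \<Phi> (y - h)) =
      (LINT t|lborel. indicator {y - h<..y} t * G y) - (LINT t|lborel. indicator {y - h<..y} t * G t)"
    using \<open>0 \<le> h\<close> by simp
  also have "\<dots> = (LINT t|lborel. indicator {y - h<..y} t * G y - indicator {y - h<..y} t * G t)"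
    by (intro Bochner_Integration.integral_diff[symmetric] int int_const) auto
  also have "\<dots> = (LINT t|lborel. indicator {y - h<..y} t * (G y - G t))"
    by (simp add: algebra_simps)
  finally have eq: "h * G y - (\<Phi> y - \<Phi> (y - h)) = (LINT t|lborel. indicator {y - h<..y} t * (G y - G t))" .
  have "ennreal (norm (LINT t|lborel. indicator {y - h<..y} t * (G y - G t)))
          \<le> (\<integral>\<^sup>+t. norm (indicator {y - h<..y} t * (G y - G t)) \<partial>lborel)"
  proof (rule integral_norm_bound_ennreal)
    have "integrable lborel (\<lambda>t. indicator {y - h<..y} t * G y - indicator {y - h<..y} t * G t)"
      by (intro Bochner_Integration.integrable_diff int int_const) auto
    thus "integrable lborel (\<lambda>t. indicator {y - h<..y} t * (G y - G t))"
      by (simp add: algebra_simps)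
  qed
  also have "\<dots> = (\<integral>\<^sup>+t. ennreal \<bar>G y - G t\<bar> * indicator {y - h<..y} t \<partial>lborel)"
    by (intro nn_integral_cong) (auto simp: indicator_def)
  \<comment> \<open>The reflection \<open>t = y - r\<close> maps \<open>{y - h<..y}\<close> onto
    \<open>{0..<h}\<close>.\<close>
  also have "\<dots> = (\<integral>\<^sup>+r. ennreal \<bar>G y - G (y - r)\<bar> * indicator {y - h<..y} (y - r) \<partial>lborel)"
    by (subst nn_integral_real_affine[where c = "-1" and t = y]) auto
  also have "\<dots> = (\<integral>\<^sup>+r. ennreal \<bar>G y - G (y - r)\<bar> * indicator {0..<h} r \<partial>lborel)"
    by (intro nn_integral_cong) (auto simp: indicator_def)
  finally show ?thesis
    by (simp add: eq)
qed

text \<open>Telescoping splits the error of the right-endpoint sum into cell errors. After Fubini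
  the inner integral for a displacement \<open>r\<close> is an \<open>L^1\<close> translation
  difference of \<open>G\<close>, bounded by \<open>e\<close>; integrating over \<open>r\<close>
  gives \<open>h * e\<close> per cell.\<close>

lemma riemann_sum_L1_error:
  fixes G :: "real \<Rightarrow> real" and e :: ennreal
  assumes G: "integrable lborel G" and "0 \<le> h"
    and le: "\<And>r. r \<in> {0..<h} \<Longrightarrow> (\<integral>\<^sup>+x. ennreal \<bar>G (x + r) - G x\<bar> * indicator {a..} x \<partial>lborel) \<le> e"
  defines "\<Phi> \<equiv> \<lambda>y. LINT t|lborel. indicator {..y} t * G t"
  shows "(\<integral>\<^sup>+x. ennreal \<bar>(\<Sum>j<n. h * G (x + real (Suc j) * h)) - (\<Phi> (x + real n * h) - \<Phi> x)\<bar> * indicator {a..} x \<partial>lborel)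
           \<le> ennreal (real n * h) * e"
proof -
  note [measurable] = borel_measurable_integrable[OF G]
  define D where "D y = (\<integral>\<^sup>+r. ennreal \<bar>G y - G (y - r)\<bar> * indicator {0..<h} r \<partial>lborel)" for y
  have [measurable]: "D \<in> borel_measurable borel"
    unfolding D_def by measurable
  have pointwise: "ennreal \<bar>(\<Sum>j<n. h * G (x + real (Suc j) * h)) - (\<Phi> (x + real n * h) - \<Phi> x)\<bar>
          \<le> (\<Sum>j<n. D (x + real (Suc j) * h))" for x
  proof -
    have "\<Phi> (x + real n * h) - \<Phi> x = (\<Sum>j<n. \<Phi> (x + real (Suc j) * h) - \<Phi> (x + real j * h))"
      using sum_lessThan_telescope[of "\<lambda>j. \<Phi> (x + real j * h)" n] by simp
    hence "(\<Sum>j<n. h * G (x + real (Suc j) * h)) - (\<Phi> (x + real n * h) - \<Phi> x) =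
       (\<Sum>j<n. h * G (x + real (Suc j) * h) - (\<Phi> (x + real (Suc j) * h) - \<Phi> (x + real j * h)))"
      by (simp only: sum_subtractf)
    hence "ennreal \<bar>(\<Sum>j<n. h * G (x + real (Suc j) * h)) - (\<Phi> (x + real n * h) - \<Phi> x)\<bar> \<le>
       ennreal (\<Sum>j<n. \<bar>h * G (x + real (Suc j) * h) - (\<Phi> (x + real (Suc j) * h) - \<Phi> (x + real j * h))\<bar>)"
      by (simp only:) (intro ennreal_leI sum_abs)
    also have "\<dots> = (\<Sum>j<n. ennreal \<bar>h * G (x + real (Suc j) * h) - (\<Phi> (x + real (Suc j) * h) - \<Phi> (x + real j * h))\<bar>)"
      by (rule sum_ennreal[symmetric]) auto
    also have "\<dots> \<le> (\<Sum>j<n. D (x + real (Suc j) * h))"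
    proof (rule sum_mono)
      fix j
      have "x + real (Suc j) * h - h = x + real j * h"
        by (simp add: algebra_simps)
      thus "ennreal \<bar>h * G (x + real (Suc j) * h) - (\<Phi> (x + real (Suc j) * h) - \<Phi> (x + real j * h))\<bar>
              \<le> D (x + real (Suc j) * h)"
        using riemann_cell_error[OF G \<open>0 \<le> h\<close>, of "x + real (Suc j) * h"]
        unfolding \<Phi>_def D_def by (simp only:)
    qed
    finally show ?thesis .
  qed
  have cell: "(\<integral>\<^sup>+x. D (x + real (Suc j) * h) * indicator {a..} x \<partial>lborel) \<le> ennreal h * e" for j
  proof -
    define b where "b = real (Suc j) * h"
    have "h \<le> b"
      using \<open>0 \<le> h\<close> by (simp add: b_def algebra_simps)
    have "(\<integral>\<^sup>+x. D (x + b) * indicator {a..} x \<partial>lborel) =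
          (\<integral>\<^sup>+x. (\<integral>\<^sup>+r. ennreal \<bar>G (x + b) - G (x + b - r)\<bar> * indicator {0..<h} r * indicator {a..} x \<partial>lborel) \<partial>lborel)"
      unfolding D_def by (intro nn_integral_cong nn_integral_multc[symmetric]) measurable
    also have "\<dots> = (\<integral>\<^sup>+r. (\<integral>\<^sup>+x. ennreal \<bar>G (x + b) - G (x + b - r)\<bar> * indicator {0..<h} r * indicator {a..} x \<partial>lborel) \<partial>lborel)"
      by (rule lborel_pair.Fubini') measurable
    also have "\<dots> \<le> (\<integral>\<^sup>+r. e * indicator {0..<h} r \<partial>lborel)"
    proof (rule nn_integral_mono)
      fix r :: real
      show "(\<integral>\<^sup>+x. ennreal \<bar>G (x + b) - G (x + b - r)\<bar> * indicator {0..<h} r * indicator {a..} x \<partial>lborel)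
              \<le> e * indicator {0..<h} r"
      proof (cases "r \<in> {0..<h}")
        case True
        \<comment> \<open>Since \<open>r < h \<le> b\<close>, the substitution moves
          \<open>x\<close> to the right by \<open>b - r\<close>, so \<open>{a..}\<close> is mapped
          into itself and enlarging the domain costs nothing.\<close>
        have "(\<integral>\<^sup>+x. ennreal \<bar>G (x + b) - G (x + b - r)\<bar> * indicator {0..<h} r * indicator {a..} x \<partial>lborel)
           \<le> (\<integral>\<^sup>+x. ennreal \<bar>G ((b - r + 1 * x) + r) - G (b - r + 1 * x)\<bar> * indicator {a..} (b - r + 1 * x) \<partial>lborel)"
          using True \<open>h \<le> b\<close> by (intro nn_integral_mono) (auto simp: indicator_def algebra_simps)
        also have "\<dots> = (\<integral>\<^sup>+x. ennreal \<bar>G (x + r) - G x\<bar> * indicator {a..} x \<partial>lborel)"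
          by (subst nn_integral_real_affine[where c = 1 and t = "b - r"]) auto
        also have "\<dots> \<le> e"
          by (rule le[OF True])
        finally show ?thesis using True by simp
      qed simp
    qed
    also have "\<dots> = ennreal h * e"
      using \<open>0 \<le> h\<close> by (simp add: nn_integral_cmult_indicator mult.commute)
    finally show ?thesis by (simp add: b_def)
  qed
  have "(\<integral>\<^sup>+x. ennreal \<bar>(\<Sum>j<n. h * G (x + real (Suc j) * h)) - (\<Phi> (x + real n * h) - \<Phi> x)\<bar> * indicator {a..} x \<partial>lborel)
        \<le> (\<integral>\<^sup>+x. (\<Sum>j<n. D (x + real (Suc j) * h) * indicator {a..} x) \<partial>lborel)"
    unfolding sum_distrib_right[symmetric] by (intro nn_integral_mono mult_right_mono pointwise) auto
  also have "\<dots> = (\<Sum>j<n. \<integral>\<^sup>+x. D (x + real (Suc j) * h) * indicator {a..} x \<partial>lborel)"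
    by (rule nn_integral_sum) measurable
  also have "\<dots> \<le> (\<Sum>j<n. ennreal h * e)"
    by (intro sum_mono cell)
  also have "\<dots> = ennreal (real n * h) * e"
    using \<open>0 \<le> h\<close> by (simp add: ennreal_mult ennreal_of_nat_eq_real_of_nat mult.assoc)
  finally show ?thesis .
qed

section \<open>Continuous periodic functions and a periodising cutoff\<close>

lemma C_2pi_I:
  "continuous_on UNIV f \<Longrightarrow> (\<And>x. f (x + 2 * pi) = f x) \<Longrightarrow> f \<in> C_2pi"
  by (auto simp: C_2pi_def)

lemma continuous_bounded_Icc:
  fixes f :: "real \<Rightarrow> real"
  assumes "continuous_on UNIV f"
  obtains B where "B > 0" "\<And>x. x \<in> {a..b} \<Longrightarrow> \<bar>f x\<bar> \<le> B"
proof -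
  have "compact (f ` {a..b})"
    using assms by (intro compact_continuous_image) (auto intro: continuous_on_subset)
  hence "bounded (f ` {a..b})"
    by (rule compact_imp_bounded)
  then obtain B where "B > 0" "\<forall>y\<in>f ` {a..b}. norm y \<le> B"
    unfolding bounded_pos by blast
  thus thesis
    by (intro that[of B]) auto
qed

text \<open>\<open>Arg (cis x)\<close> reduces \<open>x\<close> modulo the period and can jump only
  where \<open>cis x = -1\<close>. There the cutoff factor vanishes, and boundedness of
  \<open>k\<close> on the interval makes the product tend to \<open>0\<close>.\<close>

lemma continuous_on_Arg_cis_cutoff:
  fixes k :: "real \<Rightarrow> real"
  assumes k: "continuous_on UNIV k"
  shows "continuous_on UNIV (\<lambda>x. k (Arg (cis x)) * min 1 (c * (1 + cos x)))"
proof (rule continuous_at_imp_continuous_on, intro ballI)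
  fix x :: real
  obtain B where B: "B > 0" "\<And>x. x \<in> {-pi..pi} \<Longrightarrow> \<bar>k x\<bar> \<le> B"
    using continuous_bounded_Icc[OF k] by blast
  have kB: "\<bar>k (Arg z)\<bar> \<le> B" for z
    using Arg_bounded[of z] by (intro B) auto
  have kc: "isCont k y" for y
    using k by (simp add: continuous_on_eq_continuous_at)
  have cut: "isCont (\<lambda>x. min 1 (c * (1 + cos x))) x"
    by (intro continuous_intros)
  show "isCont (\<lambda>x. k (Arg (cis x)) * min 1 (c * (1 + cos x))) x"
  proof (cases "cis x \<in> \<real>\<^sub>\<le>\<^sub>0")
    case False
    have "isCont cis x"
      unfolding cis_conv_exp[abs_def] by (intro continuous_intros)
    hence "isCont (\<lambda>x. Arg (cis x)) x"
      by (rule isCont_o2) (rule continuous_at_Arg[OF False])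
    hence "isCont (\<lambda>x. k (Arg (cis x))) x"
      by (rule isCont_o2) (rule kc)
    thus ?thesis
      using cut by (intro continuous_intros)
  next
    case True
    hence "cis x = complex_of_real (cos x)" "cos x \<le> 0"
      by (auto simp: complex_nonpos_Reals_iff complex_eq_iff)
    hence "cos x = -1"
      by (metis abs_of_nonpos minus_minus norm_cis norm_of_real)
    hence 0: "min 1 (c * (1 + cos x)) = 0"
      by simp
    have "(\<lambda>y. B * \<bar>min 1 (c * (1 + cos y))\<bar>) \<midarrow>x\<rightarrow> B * \<bar>min 1 (c * (1 + cos x))\<bar>"
      using cut unfolding isCont_def by (intro tendsto_intros)
    hence "(\<lambda>y. B * \<bar>min 1 (c * (1 + cos y))\<bar>) \<midarrow>x\<rightarrow> 0"
      using 0 by simp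
    hence "(\<lambda>y. k (Arg (cis y)) * min 1 (c * (1 + cos y))) \<midarrow>x\<rightarrow> 0"
      by (rule Lim_null_comparison[rotated])
        (auto simp: abs_mult intro!: always_eventually mult_right_mono kB)
    thus ?thesis
      using 0 by (simp add: isCont_def)
  qed
qed

section \<open>Absolute continuity of the norm of the constant function, and density\<close>

locale pi_ac_function_norm = pi_function_norm +
  assumes one_ac: "(\<lambda>x. 1) \<in> bfs_ac interval_measure_pi \<rho>"
begin

lemma norm_one_finite: "N (\<lambda>x. 1) < \<infinity>"
  using one_ac by (auto simp: bfs_ac_def bfs_iff)

lemma norm_indicator_tendsto:
  assumes "\<And>n::nat. E n \<in> sets Mpi" "AE x in Mpi. (\<lambda>n. indicator (E n) x :: real) \<longlonglongrightarrow> 0"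
  shows "(\<lambda>n. N (indicator (E n))) \<longlonglongrightarrow> 0"
proof -
  have "(\<lambda>n. N (\<lambda>x. 1 * indicator (E n) x)) \<longlonglongrightarrow> 0"
    using one_ac assms unfolding bfs_ac_def by blast
  thus ?thesis by simp
qed

lemma norm_cmult_indicator_small:
  assumes "\<And>n::nat. E n \<in> sets Mpi" "AE x in Mpi. (\<lambda>n. indicator (E n) x :: real) \<longlonglongrightarrow> 0"
    and "\<epsilon> > (0 :: ennreal)"
  obtains n where "n > 0" "ennreal B * N (indicator (E n)) < \<epsilon>"
proof -
  have "(\<lambda>n. ennreal B * N (indicator (E n))) \<longlonglongrightarrow> ennreal B * 0"
    using norm_indicator_tendsto[OF assms(1,2)] by (intro ennreal_tendsto_cmult) auto
  hence "\<forall>\<^sub>F n in sequentially. ennreal B * N (indicator (E n)) < \<epsilon>"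
    using assms(3) by (intro order_tendstoD(2)) auto
  hence "\<forall>\<^sub>F n in sequentially. ennreal B * N (indicator (E n)) < \<epsilon> \<and> n > 0"
    using eventually_gt_at_top[of 0] by eventually_elim simp
  thus thesis
    using that by (auto simp: eventually_sequentially)
qed

lemma norm_bounded_finite:
  assumes "f \<in> borel_measurable Mpi" "AE x in Mpi. \<bar>f x\<bar> \<le> B" "0 \<le> B"
  shows "N f < \<infinity>"
  using norm_le_const[OF assms] norm_one_finite
  by (auto simp: ennreal_mult_less_top intro: le_less_trans)

text \<open>Finiteness of the norm of \<open>1\<close> allows a norm tolerance to be replaced by a
  uniform one.\<close>

lemma small_const:
  assumes "\<epsilon> > (0 :: ennreal)"
  obtains \<eta> :: real where "\<eta> > 0" "ennreal \<eta> * N (\<lambda>x. 1) < \<epsilon>"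
proof -
  obtain c where c: "N (\<lambda>x. 1) = ennreal c" "0 \<le> c"
    using norm_one_finite by (cases "N (\<lambda>x. 1)" rule: ennreal_cases) auto
  have "(\<lambda>n. ennreal (inverse (real (Suc n)) * c)) \<longlonglongrightarrow> ennreal (0 * c)"
    by (intro tendsto_ennrealI tendsto_mult tendsto_const LIMSEQ_inverse_real_of_nat)
  hence "\<forall>\<^sub>F n in sequentially. ennreal (inverse (real (Suc n)) * c) < \<epsilon>"
    using assms by (intro order_tendstoD(2)) auto
  then obtain n where "ennreal (inverse (real (Suc n)) * c) < \<epsilon>"
    by (auto simp: eventually_sequentially)
  thus thesis
    using c by (intro that[of "inverse (real (Suc n))"]) (auto simp: ennreal_mult)
qed

text \<open>Where \<open>x + \<delta>\<close> stays in the interval, uniform continuity bounds the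
  difference. The remaining points form a strip at \<open>pi\<close>, where the translate is
  \<open>0\<close> and the difference is at most \<open>B\<close>; the strip has small norm because
  \<open>1\<close> has absolutely continuous norm.\<close>

lemma continuous_imp_tc:
  assumes f: "continuous_on UNIV f"
  shows "f \<in> translation_continuous \<rho>"
proof -
  have fb: "f \<in> borel_measurable borel"
    using f by (rule borel_measurable_continuous_onI)
  note [measurable] = fb borel_imp_Mpi_measurable[OF fb]
  obtain B where B: "B > 0" "\<And>x. x \<in> {-pi..pi} \<Longrightarrow> \<bar>f x\<bar> \<le> B"
    using continuous_bounded_Icc[OF f] by blast
  have "N f < \<infinity>"
    using B by (intro norm_bounded_finite[of f B]) (auto intro!: AE_I2)
  moreover have "((\<lambda>\<delta>. N (\<lambda>x. translate \<delta> f x - f x)) \<longlongrightarrow> 0) (at_right 0)"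
  proof (rule order_tendstoI)
    fix \<epsilon> :: ennreal assume "0 < \<epsilon>"
    hence e2: "0 < \<epsilon> / 2" by (simp add: ennreal_zero_less_divide)
    obtain \<eta> where \<eta>: "\<eta> > 0" "ennreal \<eta> * N (\<lambda>x. 1) < \<epsilon> / 2"
      using small_const[OF e2] by blast
    have "uniformly_continuous_on {-pi..pi} f"
      using f by (intro compact_uniformly_continuous) (auto intro: continuous_on_subset)
    then obtain d where d: "d > 0"
      "\<And>x y. x \<in> {-pi..pi} \<Longrightarrow> y \<in> {-pi..pi} \<Longrightarrow> dist y x < d \<Longrightarrow> dist (f y) (f x) < \<eta>"
      using \<eta>(1) unfolding uniformly_continuous_on_def by meson
    \<comment> \<open>Only the right end matters, as translations go one way. For each
      \<open>x < pi\<close> in the interval the indicators are eventually \<open>0\<close>; the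
      point \<open>pi\<close> itself is discarded as a null set.\<close>
    define E where "E n = {pi - 1 / real n<..pi} \<inter> {-pi..pi}" for n :: nat
    have E: "E n \<in> sets Mpi" for n
      by (auto simp: E_def sets_Mpi_iff)
    obtain n where n: "n > 0" "ennreal B * N (indicator (E n)) < \<epsilon> / 2"
    proof (rule norm_cmult_indicator_small[OF E _ e2])
      show "AE x in Mpi. (\<lambda>n. indicator (E n) x :: real) \<longlonglongrightarrow> 0"
        unfolding AE_Mpi_iff using AE_lborel_singleton[of pi]
      proof eventually_elim
        case (elim x)
        show ?case
        proof
          assume "x \<in> {-pi..pi}"
          hence "0 < pi - x" using elim by auto
          moreover have "(\<lambda>n. 1 / real n) \<longlonglongrightarrow> 0"
            by (rule lim_1_over_n)
          ultimately have "\<forall>\<^sub>F n in sequentially. 1 / real n < pi - x"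
            by (intro order_tendstoD(2)) auto
          hence "\<forall>\<^sub>F n in sequentially. indicator (E n) x = (0 :: real)"
            by eventually_elim (auto simp: E_def)
          thus "(\<lambda>n. indicator (E n) x :: real) \<longlonglongrightarrow> 0"
            by (rule tendsto_eventually)
        qed
      qed
    qed blast
    have "N (\<lambda>x. translate \<delta> f x - f x) < \<epsilon>" if \<delta>: "0 < \<delta>" "\<delta> < min d (1 / real n)" for \<delta>
    proof -
      have ind [measurable]: "indicator (E n) \<in> borel_measurable Mpi"
        using E by simp
      have "N (\<lambda>x. translate \<delta> f x - f x) \<le> N (\<lambda>x. \<eta> * 1 + B * indicator (E n) x)"
      proof (intro norm_mono AE_I2)
        fix x assume "x \<in> space Mpi"
        hence x: "x \<in> {-pi..pi}" by simp
        show "\<bar>translate \<delta> f x - f x\<bar> \<le> \<bar>\<eta> * 1 + B * indicator (E n) x\<bar>"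
        proof (cases "x + \<delta> \<in> {-pi..pi}")
          case True
          hence "\<bar>f (x + \<delta>) - f x\<bar> < \<eta>"
            using d(2)[OF x True] \<delta> by (simp add: dist_real_def)
          moreover have "0 \<le> B * indicator (E n) x"
            using B(1) by simp
          ultimately show ?thesis
            using True \<eta>(1) by (simp add: translate_def)
        next
          case False
          hence "x \<in> E n"
            using x \<delta> by (auto simp: E_def)
          thus ?thesis
            using False B(2)[OF x] \<eta>(1) B(1) by (auto simp: translate_def)
        qed
      qed auto
      also have "\<dots> \<le> N (\<lambda>x. \<eta> * 1) + N (\<lambda>x. B * indicator (E n) x)"
        by (intro norm_add) auto
      also have "\<dots> = ennreal \<eta> * N (\<lambda>x. 1) + ennreal B * N (indicator (E n))"
        using \<eta>(1) B(1) by (subst (1 2) norm_cmult) auto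
      also have "\<dots> < \<epsilon> / 2 + \<epsilon> / 2"
        by (intro add_strict_mono \<eta> n)
      finally show ?thesis
        by (simp add: ennreal_half_plus_half)
    qed
    moreover have "\<forall>\<^sub>F \<delta> in at_right 0. 0 < \<delta> \<and> \<delta> < min d (1 / real n)"
      using d(1) n(1) by (intro eventually_conj eventually_at_right_less)
        (auto intro!: eventually_at_rightI[of 0 "min d (1 / real n)"])
    ultimately show "\<forall>\<^sub>F \<delta> in at_right 0. N (\<lambda>x. translate \<delta> f x - f x) < \<epsilon>"
      by (auto elim: eventually_mono)
  qed auto
  ultimately show ?thesis
    by (auto simp: translation_continuous_def bfs_iff)
qed

lemma C_2pi_in_XS_2pi: "f \<in> C_2pi \<Longrightarrow> f \<in> XS_2pi \<rho>"
  using subsetD[OF tc_subset_XS continuous_imp_tc[of f]]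
  by (auto simp: C_2pi_def XS_2pi_def intro: borel_measurable_continuous_onI)

text \<open>The approximant \<open>k\<close> is the Steklov mean over
  \<open>[x, x + \<delta>]\<close>. Its Riemann sums \<open>R n\<close> are averages of translates
  of \<open>g\<close> by at most \<open>\<delta>\<close>, so they stay within
  \<open>\<epsilon>\<close> of \<open>g\<close>; convergence of a subsequence to \<open>k\<close>
  almost everywhere then suffices for \<open>norm_fatou\<close>.\<close>

lemma tc_approx_continuous:
  assumes g: "g \<in> translation_continuous \<rho>" and "\<epsilon> > (0 :: real)"
  obtains k where "continuous_on UNIV k" "N (\<lambda>x. k x - g x) \<le> ennreal \<epsilon>"
proof -
  note [measurable] = tc_measurable[OF g]
  define w where "w r = N (\<lambda>x. translate r g x - g x)" for r
  \<comment> \<open>Extension by zero turns the truncated translation of \<open>g\<close> into an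
    ordinary shift of \<open>G\<close>.\<close>
  define G where "G x = indicator {-pi..pi} x * g x" for x
  have [measurable]: "G \<in> borel_measurable borel"
    using tc_measurable[OF g] unfolding G_def[abs_def] borel_measurable_Mpi_iff .
  have GM [measurable]: "(\<lambda>x. G (x + c)) \<in> borel_measurable Mpi" for c
    by (rule borel_imp_Mpi_measurable) measurable
  have tr: "translate r g x = G (x + r)" for r x
    by (simp add: translate_eq G_def)
  obtain C :: real where C: "C > 0"
    "\<And>f. f \<in> borel_measurable Mpi \<Longrightarrow> (\<integral>\<^sup>+x. ennreal \<bar>f x\<bar> \<partial>Mpi) \<le> ennreal C * N f"
    using L1_bound[OF emeasure_Mpi_finite] by blast
  \<comment> \<open>A limit from the right says nothing at \<open>r = 0\<close>, but the Riemann sum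
    estimate includes that displacement.\<close>
  have w0: "w 0 = 0"
  proof -
    have "(\<lambda>x. translate 0 g x - g x) \<in> borel_measurable Mpi"
      by measurable
    thus ?thesis
      unfolding w_def by (subst norm_eq_0_iff) (auto intro!: AE_I2 simp: translate_def)
  qed
  have w_small: "\<exists>d>0. \<forall>r. 0 \<le> r \<and> r \<le> d \<longrightarrow> w r \<le> ennreal e" if "e > 0" for e
  proof -
    have "\<forall>\<^sub>F r in at_right 0. w r < ennreal e"
      using g that unfolding w_def translation_continuous_def by (intro order_tendstoD(2)) auto
    then obtain d where d: "d > 0" "\<And>r. 0 < r \<Longrightarrow> r < d \<Longrightarrow> w r < ennreal e"
      unfolding eventually_at_right_field by auto
    have "w r \<le> ennreal e" if "0 \<le> r" "r \<le> d / 2" for r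
      using d(1) d(2)[of r] that w0 by (cases "r = 0") auto
    thus ?thesis
      using d(1) by (intro exI[of _ "d / 2"]) auto
  qed
  have G_int: "integrable lborel G"
  proof (rule integrableI_bounded)
    have "(\<integral>\<^sup>+x. ennreal (norm (G x)) \<partial>lborel) = (\<integral>\<^sup>+x. ennreal \<bar>g x\<bar> \<partial>Mpi)"
      by (subst nn_integral_restrict_space) (auto intro!: nn_integral_cong simp: G_def indicator_def)
    also have "\<dots> \<le> ennreal C * N g"
      by (rule C(2)) measurable
    also have "\<dots> < \<infinity>"
      using g by (auto simp: translation_continuous_def bfs_iff ennreal_mult_less_top)
    finally show "(\<integral>\<^sup>+x. ennreal (norm (G x)) \<partial>lborel) < \<infinity>" .
  qed measurable
  \<comment> \<open>For \<open>x > pi\<close> and \<open>r \<ge> 0\<close> both \<open>G x\<close>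
    and \<open>G (x + r)\<close> are \<open>0\<close>, so the half line contributes no more than the
    interval.\<close>
  have shift: "(\<integral>\<^sup>+x. ennreal \<bar>G (x + r) - G x\<bar> * indicator {-pi..} x \<partial>lborel) \<le> ennreal C * w r"
    if "0 \<le> r" for r
  proof -
    have "(\<integral>\<^sup>+x. ennreal \<bar>G (x + r) - G x\<bar> * indicator {-pi..} x \<partial>lborel) =
          (\<integral>\<^sup>+x. ennreal \<bar>translate r g x - g x\<bar> \<partial>Mpi)"
      using that by (subst nn_integral_restrict_space)
        (auto intro!: nn_integral_cong simp: G_def indicator_def tr)
    also have "\<dots> \<le> ennreal C * w r"
      unfolding w_def by (rule C(2)) measurable
    finally show ?thesis .
  qed
  obtain \<delta> where \<delta>: "\<delta> > 0" "\<And>r. 0 \<le> r \<Longrightarrow> r \<le> \<delta> \<Longrightarrow> w r \<le> ennreal \<epsilon>"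
    using w_small[OF \<open>\<epsilon> > 0\<close>] by blast
  define \<Phi> where "\<Phi> y = (LINT t|lborel. indicator {..y} t * G t)" for y
  have \<Phi>_cont: "continuous_on UNIV \<Phi>"
    unfolding \<Phi>_def[abs_def] by (rule continuous_on_integral_atMost[OF G_int])
  define k where "k x = (\<Phi> (x + \<delta>) - \<Phi> x) / \<delta>" for x
  have k_cont: "continuous_on UNIV k"
    unfolding k_def[abs_def] using \<delta>(1)
    by (intro continuous_intros continuous_on_compose2[OF \<Phi>_cont]) auto
  have kb: "k \<in> borel_measurable borel"
    using k_cont by (rule borel_measurable_continuous_onI)
  note [measurable] = kb borel_imp_Mpi_measurable[OF kb]
  \<comment> \<open>With \<open>Suc n\<close> cells the mesh is defined for every \<open>n\<close>
    and the last node is exactly \<open>x + \<delta>\<close>.\<close>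
  define h where "h n = \<delta> / real (Suc n)" for n
  define R where "R n x = (\<Sum>j<Suc n. inverse (real (Suc n)) * G (x + real (Suc j) * h n))" for n x
  have h: "0 < h n" "real (Suc n) * h n = \<delta>" for n
    using \<delta>(1) by (auto simp: h_def)
  have h_le: "real (Suc j) * h n \<le> \<delta>" if "j < Suc n" for j n
  proof -
    have "real (Suc j) * h n \<le> real (Suc n) * h n"
      using that h(1)[of n] by (intro mult_right_mono) auto
    thus ?thesis using h(2) by simp
  qed
  have [measurable]: "R n \<in> borel_measurable Mpi" for n
    unfolding R_def[abs_def] by measurable
  have R_k: "R n x - k x = ((\<Sum>j<Suc n. h n * G (x + real (Suc j) * h n)) - (\<Phi> (x + real (Suc n) * h n) - \<Phi> x)) / \<delta>"
    for n x
  proof -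
    have "h n / \<delta> = inverse (real (Suc n))"
      using \<delta>(1) by (simp add: h_def divide_inverse del: of_nat_Suc)
    thus ?thesis
      unfolding h(2) by (simp only: R_def k_def diff_divide_distrib sum_divide_distrib times_divide_eq_left[symmetric])
  qed
  have L1: "(\<integral>\<^sup>+x. ennreal \<bar>R n x - k x\<bar> \<partial>Mpi) \<le> ennreal (C * e)"
    if e: "\<And>r. 0 \<le> r \<Longrightarrow> r \<le> h n \<Longrightarrow> w r \<le> ennreal e" "e \<ge> 0" for n e
  proof -
    let ?u = "\<lambda>x. (\<Sum>j<Suc n. h n * G (x + real (Suc j) * h n)) - (\<Phi> (x + real (Suc n) * h n) - \<Phi> x)"
    have [measurable]: "\<Phi> \<in> borel_measurable borel"
      using \<Phi>_cont by (rule borel_measurable_continuous_onI)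
    have "(\<integral>\<^sup>+x. ennreal \<bar>R n x - k x\<bar> \<partial>Mpi) =
          (\<integral>\<^sup>+x. ennreal (1 / \<delta>) * (ennreal \<bar>?u x\<bar> * indicator {-pi..pi} x) \<partial>lborel)"
      using \<delta>(1) by (subst nn_integral_restrict_space)
        (auto intro!: nn_integral_cong simp: R_k abs_mult divide_inverse ennreal_mult mult_ac simp del: sum.lessThan_Suc)
    also have "\<dots> = ennreal (1 / \<delta>) * (\<integral>\<^sup>+x. ennreal \<bar>?u x\<bar> * indicator {-pi..pi} x \<partial>lborel)"
      by (rule nn_integral_cmult) measurable
    also have "\<dots> \<le> ennreal (1 / \<delta>) * (\<integral>\<^sup>+x. ennreal \<bar>?u x\<bar> * indicator {-pi..} x \<partial>lborel)"
      by (intro mult_left_mono nn_integral_mono) (auto simp: indicator_def)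
    \<comment> \<open>The factor \<open>real (Suc n) * h n\<close> equals \<open>\<delta>\<close>
      and cancels \<open>1 / \<delta>\<close>, so the bound depends only on the modulus of
      \<open>g\<close> on the scale of the mesh.\<close>
    also have "\<dots> \<le> ennreal (1 / \<delta>) * (ennreal (real (Suc n) * h n) * ennreal (C * e))"
      unfolding \<Phi>_def
    proof (intro mult_left_mono riemann_sum_L1_error G_int)
      fix r assume r: "r \<in> {0..<h n}"
      have "(\<integral>\<^sup>+x. ennreal \<bar>G (x + r) - G x\<bar> * indicator {-pi..} x \<partial>lborel) \<le> ennreal C * w r"
        using r by (intro shift) auto
      also have "\<dots> \<le> ennreal C * ennreal e"
        using r by (intro mult_left_mono e) auto
      also have "\<dots> = ennreal (C * e)"
        using C(1) e(2) by (simp add: ennreal_mult)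
      finally show "(\<integral>\<^sup>+x. ennreal \<bar>G (x + r) - G x\<bar> * indicator {-pi..} x \<partial>lborel) \<le> ennreal (C * e)" .
    qed (use h(1)[of n] in auto)
    also have "\<dots> = ennreal (C * e)"
      using \<delta>(1) C(1) e(2) unfolding h(2) by (simp flip: ennreal_mult)
    finally show ?thesis .
  qed
  have int: "integrable Mpi (\<lambda>x. R n x - k x)" for n
  proof (rule integrableI_bounded)
    have "h n \<le> \<delta>"
      using h_le[of 0 n] h(1)[of n] by simp
    hence "(\<integral>\<^sup>+x. ennreal \<bar>R n x - k x\<bar> \<partial>Mpi) \<le> ennreal (C * \<epsilon>)"
      using \<open>\<epsilon> > 0\<close> by (intro L1 \<delta>(2)) auto
    also have "\<dots> < \<infinity>" by simp
    finally show "(\<integral>\<^sup>+x. ennreal (norm (R n x - k x)) \<partial>Mpi) < \<infinity>"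
      by simp
  qed measurable
  have "(\<lambda>n. LINT x|Mpi. norm (R n x - k x)) \<longlonglongrightarrow> 0"
  proof (rule LIMSEQ_I)
    fix e :: real assume "e > 0"
    \<comment> \<open>Chosen so that \<open>C * e'\<close> is half of \<open>e\<close>, which leaves
      room for the strict inequality.\<close>
    define e' where "e' = e / (2 * C)"
    have e': "e' > 0" using \<open>e > 0\<close> C(1) by (simp add: e'_def)
    obtain d where d: "d > 0" "\<And>r. 0 \<le> r \<Longrightarrow> r \<le> d \<Longrightarrow> w r \<le> ennreal e'"
      using w_small[OF e'] by blast
    have "(\<lambda>n. \<delta> * inverse (real (Suc n))) \<longlonglongrightarrow> \<delta> * 0"
      by (intro tendsto_mult tendsto_const LIMSEQ_inverse_real_of_nat)
    hence "\<forall>\<^sub>F n in sequentially. \<delta> * inverse (real (Suc n)) < d"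
      using d(1) by (intro order_tendstoD(2)) auto
    then obtain n0 where n0: "\<And>n. n \<ge> n0 \<Longrightarrow> h n < d"
      by (auto simp: eventually_sequentially h_def divide_inverse)
    have "norm ((LINT x|Mpi. norm (R n x - k x)) - 0) < e" if "n \<ge> n0" for n
    proof -
      have "ennreal (LINT x|Mpi. norm (R n x - k x)) = (\<integral>\<^sup>+x. ennreal (norm (R n x - k x)) \<partial>Mpi)"
        using int[of n] by (intro nn_integral_eq_integral[symmetric]) auto
      also have "\<dots> \<le> ennreal (C * e')"
        unfolding real_norm_def using n0[OF that] e' by (intro L1 d(2)) auto
      finally have "(LINT x|Mpi. norm (R n x - k x)) \<le> C * e'"
        using C(1) e' by (subst (asm) ennreal_le_iff) auto
      also have "\<dots> < e"
        using C(1) \<open>e > 0\<close> by (simp add: e'_def)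
      finally show ?thesis by simp
    qed
    thus "\<exists>n0. \<forall>n\<ge>n0. norm ((LINT x|Mpi. norm (R n x - k x)) - 0) < e"
      by blast
  qed
  \<comment> \<open>\<open>L^1\<close> convergence yields convergence almost everywhere only along a
    subsequence; the bound \<open>R_g\<close> is uniform in \<open>n\<close>, so nothing is
    lost.\<close>
  then obtain s :: "nat \<Rightarrow> nat" where s: "AE x in Mpi. (\<lambda>n. R (s n) x - k x) \<longlonglongrightarrow> 0"
    using tendsto_L1_AE_subseq[of Mpi "\<lambda>n x. R n x - k x"] int by blast
  have R_g: "N (\<lambda>x. R n x - g x) \<le> ennreal \<epsilon>" for n
  proof -
    have "R n x - g x = (\<Sum>j<Suc n. inverse (real (Suc n)) * (translate (real (Suc j) * h n) g x - g x))" for x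
      by (simp add: R_def tr right_diff_distrib sum_subtractf del: sum.lessThan_Suc of_nat_Suc)
    hence "N (\<lambda>x. R n x - g x) \<le> (\<Sum>j<Suc n. N (\<lambda>x. inverse (real (Suc n)) * (translate (real (Suc j) * h n) g x - g x)))"
      by (simp only:) (intro norm_sum, auto)
    also have "\<dots> = (\<Sum>j<Suc n. ennreal (inverse (real (Suc n))) * w (real (Suc j) * h n))"
      unfolding w_def by (intro sum.cong refl, subst norm_cmult) auto
    also have "\<dots> \<le> (\<Sum>j<Suc n. ennreal (inverse (real (Suc n))) * ennreal \<epsilon>)"
      using h(1)[of n] by (intro sum_mono mult_left_mono \<delta>(2) h_le) auto
    also have "\<dots> = ennreal (\<Sum>j<Suc n. inverse (real (Suc n)) * \<epsilon>)"
      using \<open>\<epsilon> > 0\<close> by (subst sum_ennreal[symmetric]) (auto simp: ennreal_mult simp del: of_nat_Suc sum.lessThan_Suc)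
    also have "\<dots> = ennreal \<epsilon>"
      by (simp add: mult.assoc[symmetric] del: of_nat_Suc sum.lessThan_Suc)
    finally show ?thesis .
  qed
  have "N (\<lambda>x. k x - g x) \<le> ennreal \<epsilon>"
  proof (rule norm_fatou[of "\<lambda>n x. R (s n) x - g x"])
    show "AE x in Mpi. (\<lambda>n. R (s n) x - g x) \<longlonglongrightarrow> k x - g x"
      using s
    proof eventually_elim
      case (elim x)
      hence "(\<lambda>n. (R (s n) x - k x) + (k x - g x)) \<longlonglongrightarrow> 0 + (k x - g x)"
        by (intro tendsto_add tendsto_const)
      thus ?case by simp
    qed
  qed (auto intro: R_g)
  thus thesis
    using k_cont that by blast
qed

text \<open>Multiplying by a cutoff that vanishes at the odd multiples of \<open>pi\<close> removes
  the mismatch of \<open>k\<close> between the two ends. Up to a null set it changes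
  \<open>k\<close> only where \<open>real n * (1 + cos x) < 1\<close>, and these sets shrink to the
  endpoints, so their norms tend to \<open>0\<close>.\<close>

lemma continuous_approx_periodic:
  assumes k: "continuous_on UNIV k" and "\<epsilon> > (0 :: ennreal)"
  obtains H where "H \<in> C_2pi" "N (\<lambda>x. k x - H x) < \<epsilon>"
proof -
  obtain B where B: "B > 0" "\<And>x. x \<in> {-pi..pi} \<Longrightarrow> \<bar>k x\<bar> \<le> B"
    using continuous_bounded_Icc[OF k] by blast
  define H where "H n x = k (Arg (cis x)) * min 1 (real n * (1 + cos x))" for n :: nat and x
  have H_cont: "continuous_on UNIV (H n)" for n
    unfolding H_def[abs_def] by (rule continuous_on_Arg_cis_cutoff[OF k])
  have H: "H n \<in> C_2pi" for n
  proof (rule C_2pi_I[OF H_cont])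
    have "cis (x + 2 * pi) = cis x" for x
      by (simp add: complex_eq_iff)
    thus "H n (x + 2 * pi) = H n x" for x
      by (simp add: H_def)
  qed
  have kb: "k \<in> borel_measurable borel"
    using k by (rule borel_measurable_continuous_onI)
  have Hb: "H n \<in> borel_measurable borel" for n
    using H_cont by (rule borel_measurable_continuous_onI)
  note [measurable] = borel_imp_Mpi_measurable[OF kb] borel_imp_Mpi_measurable[OF Hb]
  define E where "E n = {x. real n * (1 + cos x) < 1} \<inter> {-pi..pi}" for n
  have E: "E n \<in> sets Mpi" for n
  proof -
    have "open {x. real n * (1 + cos x) < 1}"
      by (intro open_Collect_less continuous_intros)
    thus ?thesis
      by (auto simp: E_def sets_Mpi_iff)
  qed
  obtain n where n: "n > 0" "ennreal B * N (indicator (E n)) < \<epsilon>"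
  proof (rule norm_cmult_indicator_small[OF E _ assms(2)])
    show "AE x in Mpi. (\<lambda>n. indicator (E n) x :: real) \<longlonglongrightarrow> 0"
      unfolding AE_Mpi_iff using AE_lborel_singleton[of pi] AE_lborel_singleton[of "-pi"]
    proof eventually_elim
      case (elim x)
      show ?case
      proof
        assume "x \<in> {-pi..pi}"
        hence "\<bar>x\<bar> < pi" using elim by auto
        hence "cos pi < cos \<bar>x\<bar>"
          by (intro cos_monotone_0_pi) auto
        hence pos: "0 < 1 + cos x" by simp
        obtain n0 where n0: "1 / (1 + cos x) < real n0"
          using reals_Archimedean2 by blast
        have "indicator (E n) x = (0 :: real)" if "n \<ge> n0" for n
        proof -
          have "1 / (1 + cos x) < real n"
            using n0 that by (simp add: less_le_trans)
          hence "1 < real n * (1 + cos x)"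
            using pos by (simp add: field_simps)
          thus ?thesis by (auto simp: E_def)
        qed
        hence "\<forall>\<^sub>F n in sequentially. indicator (E n) x = (0 :: real)"
          unfolding eventually_sequentially by blast
        thus "(\<lambda>n. indicator (E n) x :: real) \<longlonglongrightarrow> 0"
          by (rule tendsto_eventually)
      qed
    qed
  qed blast
  have "N (\<lambda>x. k x - H n x) \<le> N (\<lambda>x. B * indicator (E n) x)"
  proof (rule norm_mono)
    \<comment> \<open>The left endpoint is excluded because \<open>Arg (cis (-pi))\<close> is
      \<open>pi\<close>.\<close>
    show "AE x in Mpi. \<bar>k x - H n x\<bar> \<le> \<bar>B * indicator (E n) x\<bar>"
      unfolding AE_Mpi_iff using AE_lborel_singleton[of "-pi"]
    proof eventually_elim
      case (elim x)
      show ?case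
      proof
        assume x: "x \<in> {-pi..pi}"
        hence "Arg (cis x) = x"
          using elim by (intro Arg_cis) auto
        hence H_eq: "k x - H n x = k x * (1 - min 1 (real n * (1 + cos x)))"
          by (simp add: H_def algebra_simps)
        have "0 \<le> real n * (1 + cos x)"
        proof (intro mult_nonneg_nonneg)
          show "0 \<le> 1 + cos x" using cos_ge_minus_one[of x] by linarith
        qed auto
        hence "\<bar>1 - min 1 (real n * (1 + cos x))\<bar> \<le> indicator (E n) x"
          using x by (auto simp: E_def indicator_def)
        hence "\<bar>k x - H n x\<bar> \<le> B * indicator (E n) x"
          unfolding H_eq abs_mult using B x by (intro mult_mono) auto
        thus "\<bar>k x - H n x\<bar> \<le> \<bar>B * indicator (E n) x\<bar>"
          by linarith
      qed
    qed
  qed (use E in auto)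
  also have "\<dots> = ennreal B * N (indicator (E n))"
    using E B(1) by (subst norm_cmult) auto
  also note n(2)
  finally show thesis
    using H that by blast
qed

lemma C_2pi_dense:
  assumes f: "f \<in> XS_2pi \<rho>" and "\<epsilon> > (0 :: real)"
  obtains H where "H \<in> C_2pi" "N (\<lambda>x. f x - H x) < ennreal \<epsilon>"
proof -
  have e3: "ennreal (\<epsilon> / 3) > 0"
    using \<open>\<epsilon> > 0\<close> by simp
  obtain g where g: "g \<in> translation_continuous \<rho>" "N (\<lambda>x. f x - g x) < ennreal (\<epsilon> / 3)"
    using f e3 unfolding XS_2pi_def XS_def by blast
  \<comment> \<open>The Steklov approximation gives a non-strict bound; a quarter in place of a
    third makes it strict.\<close>
  obtain k where k: "continuous_on UNIV k" "N (\<lambda>x. k x - g x) \<le> ennreal (\<epsilon> / 4)"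
    using tc_approx_continuous[OF g(1), of "\<epsilon> / 4"] \<open>\<epsilon> > 0\<close> by auto
  have "ennreal (\<epsilon> / 4) < ennreal (\<epsilon> / 3)"
    using \<open>\<epsilon> > 0\<close> by (intro ennreal_lessI) auto
  hence k': "N (\<lambda>x. g x - k x) < ennreal (\<epsilon> / 3)"
    using k(2) norm_minus_commute[of g k] by simp
  obtain H where H: "H \<in> C_2pi" "N (\<lambda>x. k x - H x) < ennreal (\<epsilon> / 3)"
    using continuous_approx_periodic[OF k(1) e3] by blast
  have meas: "f \<in> borel_measurable Mpi" "g \<in> borel_measurable Mpi" "k \<in> borel_measurable Mpi"
      "H \<in> borel_measurable Mpi"
    using XS_2pi_measurable(2)[OF f] tc_measurable[OF g(1)] tc_measurable[OF continuous_imp_tc[OF k(1)]]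
      XS_2pi_measurable(2)[OF C_2pi_in_XS_2pi[OF H(1)]] by auto
  have "N (\<lambda>x. f x - H x) \<le> N (\<lambda>x. f x - g x) + N (\<lambda>x. g x - H x)"
    by (intro norm_triangle meas)
  also have "\<dots> \<le> N (\<lambda>x. f x - g x) + (N (\<lambda>x. g x - k x) + N (\<lambda>x. k x - H x))"
    by (intro add_left_mono norm_triangle meas)
  also have "\<dots> < ennreal (\<epsilon> / 3) + (ennreal (\<epsilon> / 3) + ennreal (\<epsilon> / 3))"
    by (intro add_strict_mono g(2) k' H(2))
  also have "\<dots> = ennreal \<epsilon>"
    using \<open>\<epsilon> > 0\<close> by (simp flip: ennreal_plus)
  finally show thesis
    using H(1) that by blast
qed

end

section \<open>Positive operators and the Korovkin estimate\<close>

lemma C_2pi_periodic_int: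
  assumes "f \<in> C_2pi"
  shows "f (x + of_int m * (2 * pi)) = f x"
proof -
  interpret periodic_fun_simple f "2 * pi"
    using assms by unfold_locales (auto simp: C_2pi_def)
  show ?thesis
    by (rule plus_of_int)
qed

lemma shift_into_pi_interval: "\<exists>m :: int. x + of_int m * (2 * pi) \<in> {-pi..pi}"
proof (intro exI)
  define q where "q = (x + pi) / (2 * pi)"
  have x: "x = q * (2 * pi) - pi"
    by (simp add: q_def)
  have q: "of_int \<lfloor>q\<rfloor> \<le> q" "q \<le> of_int \<lfloor>q\<rfloor> + 1"
    by linarith+
  have "0 \<le> (q - of_int \<lfloor>q\<rfloor>) * (2 * pi)"
    using q by (intro mult_nonneg_nonneg) auto
  moreover have "(q - of_int \<lfloor>q\<rfloor>) * (2 * pi) \<le> 1 * (2 * pi)"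
  proof (intro mult_right_mono)
    show "q - of_int \<lfloor>q\<rfloor> \<le> 1" using q by linarith
  qed auto
  ultimately show "x + of_int (- \<lfloor>q\<rfloor>) * (2 * pi) \<in> {-pi..pi}"
    by (simp add: x algebra_simps)
qed

lemma cos_plus_int_period: "cos (x + of_int m * (2 * pi)) = cos x"
  using C_2pi_periodic_int[of cos x m] by (simp add: C_2pi_def continuous_on_cos continuous_on_id)

text \<open>For a small displacement uniform continuity gives \<open>\<epsilon>\<close>. Otherwise
  \<open>1 - cos (y - x)\<close> is at least \<open>1 - cos d > 0\<close>, so a large enough
  \<open>C\<close> absorbs the trivial bound \<open>2 * B\<close>. Periodicity reduces to base point
  and displacement in \<open>[-pi, pi]\<close>.\<close>

lemma korovkin_modulus:
  assumes f: "f \<in> C_2pi" and "\<epsilon> > 0"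
  obtains C where "C \<ge> 0" "\<And>x y. \<bar>f y - f x\<bar> \<le> \<epsilon> + C * (1 - cos (y - x))"
proof -
  have cont: "continuous_on UNIV f"
    using f by (auto simp: C_2pi_def)
  obtain B where B: "B > 0" "\<And>x. x \<in> {-2*pi..2*pi} \<Longrightarrow> \<bar>f x\<bar> \<le> B"
    using continuous_bounded_Icc[OF cont] by blast
  have "uniformly_continuous_on {-2*pi..2*pi} f"
    using cont by (intro compact_uniformly_continuous) (auto intro: continuous_on_subset)
  then obtain d0 where d0: "d0 > 0"
    "\<And>x y. x \<in> {-2*pi..2*pi} \<Longrightarrow> y \<in> {-2*pi..2*pi} \<Longrightarrow> dist y x < d0 \<Longrightarrow> dist (f y) (f x) < \<epsilon>"
    using \<open>\<epsilon> > 0\<close> unfolding uniformly_continuous_on_def by meson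
  \<comment> \<open>Capping at \<open>pi\<close> keeps \<open>d\<close> in the range where
    \<open>cos\<close> decreases.\<close>
  define d where "d = min d0 pi"
  have d: "0 < d" "d \<le> d0" "d \<le> pi"
    using d0(1) by (auto simp: d_def)
  have "cos d < cos 0"
    using d by (intro cos_monotone_0_pi) auto
  hence cos_d: "0 < 1 - cos d" by simp
  define C where "C = 2 * B / (1 - cos d)"
  have C: "C \<ge> 0"
    using B(1) cos_d by (simp add: C_def)
  have main: "\<bar>f (x + t) - f x\<bar> \<le> \<epsilon> + C * (1 - cos t)"
    if x: "x \<in> {-pi..pi}" and t: "t \<in> {-pi..pi}" for x t
  proof (cases "\<bar>t\<bar> < d")
    case True
    have "0 \<le> C * (1 - cos t)"
      using C by (intro mult_nonneg_nonneg) auto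
    moreover have "x + t \<in> {-2*pi..2*pi}" "x \<in> {-2*pi..2*pi}"
      using x t pi_gt_zero by auto
    ultimately show ?thesis
      using d0(2)[of x "x + t"] True d(2) by (auto simp: dist_real_def)
  next
    case False
    have "cos \<bar>t\<bar> \<le> cos d"
      using False d t by (subst cos_mono_le_eq) auto
    hence "1 - cos d \<le> 1 - cos t" by simp
    hence "C * (1 - cos d) \<le> C * (1 - cos t)"
      using C by (intro mult_left_mono) auto
    hence "2 * B \<le> C * (1 - cos t)"
      using cos_d by (simp add: C_def)
    moreover have "\<bar>f (x + t)\<bar> \<le> B" "\<bar>f x\<bar> \<le> B"
      using x t pi_gt_zero by (intro B(2); simp)+
    ultimately show ?thesis
      using \<open>\<epsilon> > 0\<close> by linarith
  qed
  show thesis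
  proof (rule that[OF C])
    fix x y :: real
    obtain m where m: "x + of_int m * (2 * pi) \<in> {-pi..pi}"
      using shift_into_pi_interval by blast
    obtain l where l: "(y - x) + of_int l * (2 * pi) \<in> {-pi..pi}"
      using shift_into_pi_interval by blast
    \<comment> \<open>The base point and the displacement are reduced by separate multiples of the
      period, so \<open>x' + t\<close> need only agree with \<open>y\<close> up to a period.\<close>
    define x' where "x' = x + of_int m * (2 * pi)"
    define t where "t = (y - x) + of_int l * (2 * pi)"
    have "x' + t = y + of_int (m + l) * (2 * pi)"
      by (simp add: x'_def t_def algebra_simps)
    hence "f (x' + t) = f y"
      by (simp only: C_2pi_periodic_int[OF f])
    moreover have "f x' = f x"
      unfolding x'_def by (rule C_2pi_periodic_int[OF f])
    moreover have "cos t = cos (y - x)"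
      unfolding t_def by (rule cos_plus_int_period)
    ultimately show "\<bar>f y - f x\<bar> \<le> \<epsilon> + C * (1 - cos (y - x))"
      using main[of x' t] m l by (simp add: x'_def t_def)
  qed
qed

lemma C_2pi_bounded:
  assumes f: "f \<in> C_2pi"
  obtains B where "B > 0" "\<And>x. \<bar>f x\<bar> \<le> B"
proof -
  obtain B where B: "B > 0" "\<And>x. x \<in> {-pi..pi} \<Longrightarrow> \<bar>f x\<bar> \<le> B"
    using continuous_bounded_Icc[of f] f by (auto simp: C_2pi_def)
  have "\<bar>f x\<bar> \<le> B" for x
    using shift_into_pi_interval[of x] B(2) C_2pi_periodic_int[OF f, of x] by metis
  thus thesis using B(1) that by blast
qed

text \<open>The inequality defines a closed set containing the dense rationals. This makes a family
  of almost everywhere statements indexed by the reals accessible to countable intersection.\<close>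

lemma all_real_if_all_rat:
  fixes u v :: "real \<Rightarrow> real"
  assumes "continuous_on UNIV u" "continuous_on UNIV v" "\<And>x. x \<in> \<rat> \<Longrightarrow> u x \<le> v x"
  shows "u x \<le> v x"
proof -
  have "closure \<rat> \<subseteq> {x. u x \<le> v x}"
    using assms by (intro closure_minimal closed_Collect_le) auto
  thus ?thesis
    by (auto simp: Rats_closure_real)
qed

section \<open>Positive operators, with identities up to null sets\<close>

locale positive_bounded_operator = pi_ac_function_norm +
  fixes T :: "(real \<Rightarrow> real) \<Rightarrow> real \<Rightarrow> real"
  assumes bounded_T: "bounded_operator \<rho> T" and positive_T: "positive_operator \<rho> T"
begin

lemma T_in: "f \<in> XS_2pi \<rho> \<Longrightarrow> T f \<in> XS_2pi \<rho>"
  using bounded_T by (auto simp: bounded_operator_def)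

lemma T_add:
  "f \<in> XS_2pi \<rho> \<Longrightarrow> g \<in> XS_2pi \<rho> \<Longrightarrow> AE x in lborel. T (\<lambda>y. f y + g y) x = T f x + T g x"
  using bounded_T by (auto simp: bounded_operator_def)

lemma T_cmult: "f \<in> XS_2pi \<rho> \<Longrightarrow> AE x in lborel. T (\<lambda>y. c * f y) x = c * T f x"
  using bounded_T by (auto simp: bounded_operator_def)

lemma T_diff:
  assumes "f \<in> XS_2pi \<rho>" "g \<in> XS_2pi \<rho>"
  shows "AE x in lborel. T (\<lambda>y. f y - g y) x = T f x - T g x"
proof -
  have "AE x in lborel. T (\<lambda>y. f y + (-1) * g y) x = T f x + T (\<lambda>y. (-1) * g y) x"
    by (intro T_add XS_2pi_cmult assms)
  moreover have "AE x in lborel. T (\<lambda>y. (-1) * g y) x = (-1) * T g x"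
    by (intro T_cmult assms)
  ultimately show ?thesis
    by eventually_elim simp
qed

lemma T_mono:
  assumes "f \<in> XS_2pi \<rho>" "g \<in> XS_2pi \<rho>" "AE x in lborel. f x \<le> g x"
  shows "AE x in lborel. T f x \<le> T g x"
proof -
  have "AE x in lborel. 0 \<le> g x - f x"
    using assms(3) by eventually_elim simp
  hence "AE x in lborel. 0 \<le> T (\<lambda>y. g y - f y) x"
    using positive_T XS_2pi_diff[OF assms(2,1)] by (auto simp: positive_operator_def)
  with T_diff[OF assms(2,1)] show ?thesis
    by eventually_elim simp
qed

lemma T_abs_le:
  assumes f: "f \<in> XS_2pi \<rho>"
  shows "AE x in lborel. \<bar>T f x\<bar> \<le> T (\<lambda>y. \<bar>f y\<bar>) x"
proof -
  have "AE x in lborel. T f x \<le> T (\<lambda>y. \<bar>f y\<bar>) x"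
    by (intro T_mono f XS_2pi_abs) auto
  moreover have "AE x in lborel. T (\<lambda>y. (-1) * f y) x \<le> T (\<lambda>y. \<bar>f y\<bar>) x"
    by (intro T_mono f XS_2pi_abs XS_2pi_cmult) auto
  moreover have "AE x in lborel. T (\<lambda>y. (-1) * f y) x = (-1) * T f x"
    by (rule T_cmult[OF f])
  ultimately show ?thesis
    by eventually_elim auto
qed

lemma norm_T_abs:
  assumes f: "f \<in> XS_2pi \<rho>"
  shows "N (T f) \<le> N (T (\<lambda>y. \<bar>f y\<bar>))"
proof (rule norm_mono)
  have "AE x in lborel. \<bar>T f x\<bar> \<le> \<bar>T (\<lambda>y. \<bar>f y\<bar>) x\<bar>"
    using T_abs_le[OF f] by eventually_elim auto
  thus "AE x in Mpi. \<bar>T f x\<bar> \<le> \<bar>T (\<lambda>y. \<bar>f y\<bar>) x\<bar>"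
    by (rule AE_Mpi_I)
qed (intro XS_2pi_measurable T_in f XS_2pi_abs)+

lemma norm_T_cmult:
  assumes f: "f \<in> XS_2pi \<rho>"
  shows "N (T (\<lambda>y. c * f y)) = ennreal \<bar>c\<bar> * N (T f)"
proof -
  have "N (T (\<lambda>y. c * f y)) = N (\<lambda>x. c * T f x)"
    using XS_2pi_measurable(2)[OF T_in[OF f]]
    by (intro norm_cong AE_Mpi_I T_cmult f XS_2pi_measurable(2) T_in XS_2pi_cmult) measurable
  thus ?thesis
    using XS_2pi_measurable(2)[OF T_in[OF f]] by (simp add: norm_cmult)
qed

lemma norm_T_diff:
  assumes f: "f \<in> XS_2pi \<rho>" and g: "g \<in> XS_2pi \<rho>"
  shows "N (\<lambda>x. T f x - T g x) = N (T (\<lambda>y. f y - g y))"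
proof -
  note [measurable] = T_in[OF f, THEN XS_2pi_measurable(2)] T_in[OF g, THEN XS_2pi_measurable(2)]
  have "AE x in lborel. T f x - T g x = T (\<lambda>y. f y - g y) x"
    using T_diff[OF f g] by eventually_elim simp
  thus ?thesis
    by (intro norm_cong AE_Mpi_I T_in[OF XS_2pi_diff[OF f g], THEN XS_2pi_measurable(2)]) measurable
qed

lemma T_norm_bound:
  obtains K :: real where "K \<ge> 0" "\<And>f. f \<in> XS_2pi \<rho> \<Longrightarrow> N (T f) \<le> ennreal K * N f"
proof -
  obtain K :: real where K: "\<And>f. f \<in> XS_2pi \<rho> \<Longrightarrow> N (T f) \<le> ennreal K * N f"
    using bounded_T unfolding bounded_operator_def by blast
  have "ennreal K \<le> ennreal (max K 0)"
    by (intro ennreal_leI) auto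
  thus thesis
    by (intro that[of "max K 0"] order_trans[OF K] mult_right_mono) auto
qed

lemma norm_T_le_operator_norm:
  assumes f: "f \<in> XS_2pi \<rho>"
  shows "N (T f) \<le> operator_norm \<rho> T * N f"
proof (cases "N f = 0")
  \<comment> \<open>No normalisation is possible here; boundedness of \<open>T\<close> forces the
    image to have norm \<open>0\<close>.\<close>
  case True
  thus ?thesis
    using T_norm_bound f by (metis mult_zero_right)
next
  case False
  obtain c where c: "N f = ennreal c" "0 < c"
    using XS_2pi_finite[OF f] False by (cases "N f" rule: ennreal_cases) (auto simp: less_le)
  define g where "g y = inverse c * f y" for y
  have "N g = ennreal \<bar>inverse c\<bar> * N f"
    unfolding g_def by (intro norm_cmult XS_2pi_measurable f)
  also have "\<dots> = 1"
    using c by (simp flip: ennreal_mult)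
  finally have "N g = 1" .
  moreover have g: "g \<in> XS_2pi \<rho>"
    unfolding g_def by (rule XS_2pi_cmult[OF f])
  ultimately have *: "N (T g) \<le> operator_norm \<rho> T"
    unfolding operator_norm_def by (intro SUP_upper) auto
  have "f = (\<lambda>y. c * g y)"
    using c by (simp add: g_def fun_eq_iff)
  hence "N (T f) = ennreal c * N (T g)"
    using norm_T_cmult[OF g, of c] c by simp
  also have "\<dots> \<le> ennreal c * operator_norm \<rho> T"
    by (intro mult_left_mono *) auto
  finally show ?thesis
    by (simp add: c mult.commute)
qed

text \<open>Expanding \<open>cos (y - x)\<close> bounds \<open>f y\<close> and \<open>- f y\<close>
  by trigonometric polynomials in \<open>y\<close>, to which positivity and linearity of
  \<open>T\<close> apply. The quantifier over \<open>x\<close> stands inside the almost everywhere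
  statement because \<open>x\<close> will later be chosen depending on \<open>t\<close>. Each
  \<open>x\<close> has its own null set, so rational \<open>x\<close> come first and continuity in
  \<open>x\<close> gives the rest.\<close>

lemma korovkin_kernel_estimate:
  assumes f: "f \<in> C_2pi" and le: "\<And>x y. \<bar>f y - f x\<bar> \<le> \<epsilon> + C * (1 - cos (y - x))"
  shows "AE t in lborel. \<forall>x. \<bar>T f t - f x * T (\<lambda>y. 1) t\<bar> \<le>
           \<epsilon> * T (\<lambda>y. 1) t + C * (T (\<lambda>y. 1) t - cos x * T cos t - sin x * T sin t)"
proof -
  have in_C: "(\<lambda>y. 1 :: real) \<in> C_2pi" "cos \<in> C_2pi" "sin \<in> C_2pi"
    by (auto intro!: C_2pi_I continuous_intros)
  note mem = C_2pi_in_XS_2pi[OF f] in_C[THEN C_2pi_in_XS_2pi]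
  \<comment> \<open>The sign \<open>s\<close> treats the two halves of the absolute value at
    once.\<close>
  have ae: "AE t in lborel. s * (T f t - f x * T (\<lambda>y. 1) t) \<le>
      \<epsilon> * T (\<lambda>y. 1) t + C * (T (\<lambda>y. 1) t - cos x * T cos t - sin x * T sin t)"
    if s: "\<bar>s\<bar> = 1" for s x :: real
  proof -
    define a where "a = \<epsilon> + C + s * f x"
    have pt: "s * f y \<le> (a * 1 + (- C * cos x) * cos y) + (- C * sin x) * sin y" for y
    proof -
      have "s * (f y - f x) \<le> \<bar>s * (f y - f x)\<bar>"
        by simp
      also have "\<dots> = \<bar>f y - f x\<bar>"
        using s by (simp add: abs_mult)
      also have "\<dots> \<le> \<epsilon> + C * (1 - cos (y - x))"
        by (rule le)
      finally show ?thesis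
        by (simp add: a_def cos_diff algebra_simps)
    qed
    define p q r where "p y = a * 1" and "q y = (- C * cos x) * cos y" and "r y = (- C * sin x) * sin y"
      for y :: real
    note pqr = p_def[abs_def] q_def[abs_def] r_def[abs_def]
    have p: "p \<in> XS_2pi \<rho>" and q: "q \<in> XS_2pi \<rho>" and r: "r \<in> XS_2pi \<rho>"
      and sf: "(\<lambda>y. s * f y) \<in> XS_2pi \<rho>"
      unfolding pqr by (rule XS_2pi_cmult, rule mem)+
    note pq = XS_2pi_add[OF p q]
    have "AE t in lborel. T (\<lambda>y. s * f y) t \<le> T (\<lambda>y. (p y + q y) + r y) t"
      by (rule T_mono[OF sf XS_2pi_add[OF pq r]]) (use pt in \<open>simp add: p_def q_def r_def\<close>)
    moreover have "AE t in lborel. T (\<lambda>y. s * f y) t = s * T f t"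
      by (rule T_cmult[OF mem(1)])
    moreover note T_add[OF pq r] T_add[OF p q]
    moreover have "AE t in lborel. T p t = a * T (\<lambda>y. 1) t"
      unfolding pqr by (rule T_cmult[OF mem(2)])
    moreover have "AE t in lborel. T q t = (- C * cos x) * T cos t"
      unfolding pqr by (rule T_cmult[OF mem(3)])
    moreover have "AE t in lborel. T r t = (- C * sin x) * T sin t"
      unfolding pqr by (rule T_cmult[OF mem(4)])
    ultimately show ?thesis
      by eventually_elim (simp add: a_def algebra_simps)
  qed
  have "AE t in lborel. \<forall>x\<in>\<rat>. \<bar>T f t - f x * T (\<lambda>y. 1) t\<bar> \<le>
      \<epsilon> * T (\<lambda>y. 1) t + C * (T (\<lambda>y. 1) t - cos x * T cos t - sin x * T sin t)"
  proof (rule AE_ball_countable'[OF _ countable_rat])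
    fix x :: real
    show "AE t in lborel. \<bar>T f t - f x * T (\<lambda>y. 1) t\<bar> \<le>
      \<epsilon> * T (\<lambda>y. 1) t + C * (T (\<lambda>y. 1) t - cos x * T cos t - sin x * T sin t)"
      using ae[of 1 x] ae[of "-1" x] by (rule AE_mp[OF eventually_conj]) (auto intro!: AE_I2)
  qed
  thus ?thesis
  proof eventually_elim
    case (elim t)
    have "continuous_on UNIV f"
      using f by (auto simp: C_2pi_def)
    hence "continuous_on UNIV (\<lambda>x. \<bar>T f t - f x * T (\<lambda>y. 1) t\<bar>)"
      "continuous_on UNIV (\<lambda>x. \<epsilon> * T (\<lambda>y. 1) t + C * (T (\<lambda>y. 1) t - cos x * T cos t - sin x * T sin t))"
      by (intro continuous_intros; assumption)+
    from all_real_if_all_rat[OF this] elim show ?case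
      by blast
  qed
qed

end

text \<open>Shifts by multiples of the period preserve null sets, and there are countably many. So
  for almost every \<open>x\<close> the truth value of \<open>P\<close> is constant along the orbit
  of \<open>x\<close>, which meets the interval at a point where \<open>P\<close> holds.\<close>

lemma AE_lborel_if_AE_Mpi_periodic:
  fixes P :: "real \<Rightarrow> bool"
  assumes [measurable]: "Measurable.pred borel P"
    and Mpi: "AE x in Mpi. P x" and per: "AE x in lborel. P (x + 2 * pi) \<longleftrightarrow> P x"
  shows "AE x in lborel. P x"
proof -
  have shift: "AE x in lborel. Q (x + of_int m * (2 * pi))"
    if [measurable]: "Measurable.pred borel Q" and "AE x in lborel. Q x" for Q and m :: int
    using AE_borel_affine[of 1 Q "of_int m * (2 * pi)"] that by (simp add: add.commute)
  have "AE x in lborel. \<forall>m :: int. P (x + of_int m * (2 * pi) + 2 * pi) \<longleftrightarrow> P (x + of_int m * (2 * pi))"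
    by (subst AE_all_countable, intro allI shift[of "\<lambda>x. P (x + 2 * pi) \<longleftrightarrow> P x"] per) measurable
  moreover have "AE x in lborel. \<forall>m :: int. x + of_int m * (2 * pi) \<in> {-pi..pi} \<longrightarrow> P (x + of_int m * (2 * pi))"
    using Mpi unfolding AE_Mpi_iff
    by (subst AE_all_countable, intro allI shift[of "\<lambda>x. x \<in> {-pi..pi} \<longrightarrow> P x"]) measurable
  ultimately show ?thesis
  proof eventually_elim
    case (elim x)
    have step: "P (x + of_int (m + 1) * (2 * pi)) \<longleftrightarrow> P (x + of_int m * (2 * pi))" for m :: int
      using elim(1) by (simp add: algebra_simps)
    have "P (x + of_int m * (2 * pi)) \<longleftrightarrow> P x" for m :: int
    proof (induction m rule: int_induct[where k = 0])
      case (step2 i)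
      thus ?case using step[of "i - 1"] by simp
    qed (use step in auto)
    thus ?case
      using elim(2) shift_into_pi_interval by blast
  qed
qed

section \<open>Uniform boundedness, convergence on continuous functions, transfer by density\<close>

context pi_ac_function_norm
begin

text \<open>A sum of nonnegative terms dominates them where it converges. Convergence holds almost
  everywhere on the interval by \<open>riesz_fischer\<close> and spreads to the line by periodicity;
  the line is required because positivity of operators is stated there.\<close>

lemma XS_2pi_term_le_suminf:
  assumes F: "\<And>k. F k \<in> XS_2pi \<rho>" and le: "\<And>k. N (F k) \<le> ennreal ((1/2) ^ k)"
    and nonneg: "\<And>k x. 0 \<le> F k x"
  shows "AE x in lborel. F k x \<le> (\<Sum>k. F k x)"
proof -
  note [measurable] = XS_2pi_measurable[OF F]
  \<comment> \<open>Rewritten as finiteness of an extended-real sum, summability becomes a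
    measurable condition.\<close>
  have iff: "summable (\<lambda>k. F k x) \<longleftrightarrow> (\<Sum>k. ennreal (F k x)) \<noteq> \<infinity>" for x
  proof
    assume "summable (\<lambda>k. F k x)"
    thus "(\<Sum>k. ennreal (F k x)) \<noteq> \<infinity>"
      unfolding infinity_ennreal_def by (rule ennreal_suminf_neq_top) (rule nonneg)
  next
    assume "(\<Sum>k. ennreal (F k x)) \<noteq> \<infinity>"
    thus "summable (\<lambda>k. F k x)"
      unfolding infinity_ennreal_def by (rule summable_suminf_not_top[OF nonneg])
  qed
  have "AE x in lborel. \<forall>k. F k (x + 2 * pi) = F k x"
    using F by (subst AE_all_countable) (auto simp: XS_2pi_def)
  hence "AE x in lborel. summable (\<lambda>k. F k (x + 2 * pi)) \<longleftrightarrow> summable (\<lambda>k. F k x)"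
    by eventually_elim simp
  moreover have "Measurable.pred borel (\<lambda>x. summable (\<lambda>k. F k x))"
    unfolding iff by measurable
  moreover have "AE x in Mpi. summable (\<lambda>k. F k x)"
  proof -
    have "AE x in Mpi. summable (\<lambda>k. \<bar>F k x\<bar>)"
      by (rule riesz_fischer(1)[OF emeasure_Mpi_finite XS_2pi_measurable(2)[OF F] le])
    thus ?thesis
      by (simp only: abs_of_nonneg[OF nonneg])
  qed
  ultimately have "AE x in lborel. summable (\<lambda>k. F k x)"
    by (rule AE_lborel_if_AE_Mpi_periodic[rotated 2])
  thus ?thesis
  proof eventually_elim
    case (elim x)
    thus ?case
      using sum_le_suminf[of "\<lambda>k. F k x" "{k}"] nonneg by simp
  qed
qed

text \<open>For positive operators the uniform boundedness principle follows by condensation of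
  singularities: a norm-convergent sum of nonnegative functions dominates each of its terms,
  and so do its images.\<close>

lemma positive_uniform_boundedness:
  fixes L :: "nat \<Rightarrow> (real \<Rightarrow> real) \<Rightarrow> real \<Rightarrow> real"
  assumes L: "\<And>n. positive_bounded_operator \<rho> (L n)"
    and pointwise: "\<And>f. f \<in> XS_2pi \<rho> \<Longrightarrow> \<exists>K<\<infinity>. \<forall>n. N (L n f) \<le> K"
  shows "(SUP n. operator_norm \<rho> (L n)) < \<infinity>"
proof (rule ccontr)
  assume "\<not> ?thesis"
  hence "(SUP n. operator_norm \<rho> (L n)) = \<infinity>"
    by (simp only: infinity_ennreal_def less_top[symmetric] not_not)
  \<comment> \<open>The growth \<open>4 ^ k\<close> beats the weights \<open>(1/2) ^ k\<close> that
    make the series converge: the images of the weighted terms still have norm at least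
    \<open>2 ^ k\<close>.\<close>
  hence "ennreal (4 ^ k) < (SUP n. operator_norm \<rho> (L n))" for k :: nat
    by (simp only:) simp
  hence "\<exists>n f. f \<in> XS_2pi \<rho> \<and> N f \<le> 1 \<and> ennreal (4 ^ k) < N (L n f)" for k :: nat
    unfolding less_SUP_iff operator_norm_def by blast
  then obtain n f where f: "\<And>k. f k \<in> XS_2pi \<rho>" "\<And>k. N (f k) \<le> 1"
      "\<And>k. ennreal (4 ^ k) < N (L (n k) (f k))"
    by metis
  define F where "F k y = (1/2) ^ k * \<bar>f k y\<bar>" for k y
  have abs_f: "(\<lambda>y. \<bar>f k y\<bar>) \<in> XS_2pi \<rho>" for k
    by (intro XS_2pi_abs f)
  have F: "F k \<in> XS_2pi \<rho>" for k
    unfolding F_def[abs_def] by (rule XS_2pi_cmult[OF abs_f])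
  have F_le: "N (F k) \<le> ennreal ((1/2) ^ k)" for k
  proof -
    have "N (F k) = ennreal \<bar>(1/2) ^ k\<bar> * N (\<lambda>y. \<bar>f k y\<bar>)"
      unfolding F_def[abs_def] by (rule norm_cmult[OF XS_2pi_measurable(2)[OF abs_f]])
    also have "\<dots> = ennreal ((1/2) ^ k) * N (f k)"
      by (simp add: bfs_norm_def)
    also have "\<dots> \<le> ennreal ((1/2) ^ k) * 1"
      by (intro mult_left_mono f) auto
    finally show ?thesis by simp
  qed
  define S where "S x = (\<Sum>k. F k x)" for x
  have S: "S \<in> XS_2pi \<rho>"
    unfolding S_def[abs_def] by (rule XS_2pi_suminf[OF F F_le])
  obtain K where K: "K < \<infinity>" "\<And>m. N (L m S) \<le> K"
    using pointwise[OF S] by blast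
  have pow_le: "ennreal (2 ^ k) \<le> K" for k
  proof -
    interpret T: positive_bounded_operator \<rho> "L (n k)"
      by (rule L)
    have F_S: "AE x in lborel. F k x \<le> S x"
      unfolding S_def using XS_2pi_term_le_suminf[of F, OF F F_le] by (simp add: F_def)
    have "AE x in lborel. \<bar>L (n k) (F k) x\<bar> \<le> L (n k) (F k) x"
    proof -
      have "(\<lambda>y. \<bar>F k y\<bar>) = F k"
        by (simp add: F_def fun_eq_iff)
      thus ?thesis
        using T.T_abs_le[OF F, of k] by simp
    qed
    hence "AE x in lborel. \<bar>L (n k) (F k) x\<bar> \<le> \<bar>L (n k) S x\<bar>"
      using T.T_mono[OF F S F_S] by eventually_elim linarith
    hence "N (L (n k) (F k)) \<le> N (L (n k) S)"
      by (intro norm_mono AE_Mpi_I XS_2pi_measurable(2) T.T_in F S)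
    also have "\<dots> \<le> K"
      by (rule K(2))
    finally have le_K: "N (L (n k) (F k)) \<le> K" .
    have "ennreal (2 ^ k) = ennreal ((1/2) ^ k) * ennreal (4 ^ k)"
      by (simp flip: ennreal_mult power_mult_distrib)
    also have "\<dots> \<le> ennreal ((1/2) ^ k) * N (L (n k) (f k))"
      using f(3)[of k] by (intro mult_left_mono) auto
    also have "\<dots> \<le> ennreal \<bar>(1/2) ^ k\<bar> * N (L (n k) (\<lambda>y. \<bar>f k y\<bar>))"
      using T.norm_T_abs[OF f(1)[of k]] by (intro mult_mono) auto
    also have "\<dots> = N (L (n k) (F k))"
      unfolding F_def[abs_def] by (rule T.norm_T_cmult[OF abs_f, symmetric])
    finally show ?thesis using le_K by simp
  qed
  obtain c where c: "K = ennreal c" "0 \<le> c"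
    using K(1) by (cases K rule: ennreal_cases) auto
  obtain k where "c < 2 ^ k"
    using real_arch_pow[of 2 c] by auto
  with pow_le[of k] c show False
    by simp
qed

text \<open>By \<open>sq\<close> and positivity, \<open>(a1 t / a0 t, a2 t / a0 t)\<close> lies on
  the unit circle, hence is \<open>(cos x, sin x)\<close> for some \<open>x\<close>. For this
  \<open>x\<close> the cosine term in the kernel estimate vanishes for \<open>A\<close> and is small
  for \<open>L n\<close>, so both images of \<open>f\<close> at \<open>t\<close> are close to
  \<open>f x * a0 t\<close>.\<close>

lemma korovkin_C_2pi:
  fixes L :: "nat \<Rightarrow> (real \<Rightarrow> real) \<Rightarrow> real \<Rightarrow> real"
  assumes L: "\<And>n. positive_bounded_operator \<rho> (L n)" and A: "positive_bounded_operator \<rho> A"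
    and sq: "\<And>t. (C_rep (A (\<lambda>x. 1)) t)\<^sup>2 = (C_rep (A cos) t)\<^sup>2 + (C_rep (A sin) t)\<^sup>2"
    and pos: "\<And>t. t \<in> {-pi..pi} \<Longrightarrow> C_rep (A (\<lambda>x. 1)) t > 0"
    and lim: "tendsto_C_2pi (\<lambda>n. L n (\<lambda>x. 1)) (A (\<lambda>x. 1))"
      "tendsto_C_2pi (\<lambda>n. L n cos) (A cos)" "tendsto_C_2pi (\<lambda>n. L n sin) (A sin)"
    and f: "f \<in> C_2pi"
  shows "(\<lambda>n. N (\<lambda>x. L n f x - A f x)) \<longlonglongrightarrow> 0"
proof (rule tendsto_zero_ennreal)
  fix r :: real assume "0 < r"
  interpret A: positive_bounded_operator \<rho> A by (rule A)
  define a0 a1 a2 where "a0 = C_rep (A (\<lambda>x. 1))" and "a1 = C_rep (A cos)" and "a2 = C_rep (A sin)"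
  note a = a0_def a1_def a2_def
  define l0 l1 l2 where "l0 n = C_rep (L n (\<lambda>x. 1))" and "l1 n = C_rep (L n cos)"
    and "l2 n = C_rep (L n sin)" for n
  note l = l0_def l1_def l2_def
  have a0: "a0 \<in> C_2pi"
    using lim(1) unfolding a tendsto_C_2pi_def by (auto intro: C_rep_in_C_2pi)
  have a0_pos: "0 < a0 t" for t
    using shift_into_pi_interval[of t] pos C_2pi_periodic_int[OF a0, of t] unfolding a by metis
  obtain M where M: "M > 0" "\<And>t. \<bar>a0 t\<bar> \<le> M"
    using C_2pi_bounded[OF a0] by blast
  obtain B where B: "B > 0" "\<And>t. \<bar>f t\<bar> \<le> B"
    using C_2pi_bounded[OF f] by blast
  obtain \<eta> where \<eta>: "\<eta> > 0" "ennreal \<eta> * N (\<lambda>x. 1) < ennreal r"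
    using small_const[of "ennreal r"] \<open>0 < r\<close> by auto
  \<comment> \<open>The two kernel estimates contribute \<open>\<epsilon> * (l0 n t + a0 t)\<close>,
    where the bracket is at most \<open>2 * M + 1\<close>; this uses up half of
    \<open>\<eta>\<close>.\<close>
  define \<epsilon> where "\<epsilon> = \<eta> / (2 * (2 * M + 1))"
  have \<epsilon>: "\<epsilon> > 0" "\<epsilon> * (2 * M + 1) = \<eta> / 2"
    using \<eta>(1) M(1) by (auto simp: \<epsilon>_def field_simps)
  obtain C where C: "C \<ge> 0" "\<And>x y. \<bar>f y - f x\<bar> \<le> \<epsilon> + C * (1 - cos (y - x))"
    using korovkin_modulus[OF f \<epsilon>(1)] by blast
  have half_cancel: "y / (2 * z) * z = y / 2" if "z > 0" for y z :: real
    using that by simp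
  \<comment> \<open>The other half of \<open>\<eta>\<close> pays for three deviations multiplied by
    \<open>C\<close> and one multiplied by the bound \<open>B\<close> of \<open>f\<close>. The cap
    at \<open>1\<close> serves the bound on \<open>l0 n t\<close>.\<close>
  define \<kappa> where "\<kappa> = min 1 (\<eta> / (2 * (3 * C + B)))"
  have CB: "3 * C + B > 0"
    using C(1) B(1) by simp
  have \<kappa>: "\<kappa> > 0" "\<kappa> \<le> 1"
    using \<eta>(1) CB by (auto simp: \<kappa>_def)
  have "\<kappa> * (3 * C + B) \<le> \<eta> / (2 * (3 * C + B)) * (3 * C + B)"
    using CB by (intro mult_right_mono) (auto simp: \<kappa>_def)
  hence \<kappa>': "\<kappa> * (3 * C + B) \<le> \<eta> / 2"
    using half_cancel[of "3 * C + B" \<eta>] CB by linarith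
  have "\<forall>\<^sub>F n in sequentially. \<forall>t\<in>UNIV. dist (l0 n t) (a0 t) < \<kappa>"
    "\<forall>\<^sub>F n in sequentially. \<forall>t\<in>UNIV. dist (l1 n t) (a1 t) < \<kappa>"
    "\<forall>\<^sub>F n in sequentially. \<forall>t\<in>UNIV. dist (l2 n t) (a2 t) < \<kappa>"
    using lim[unfolded tendsto_C_2pi_def, THEN conjunct2, THEN conjunct2, THEN uniform_limitD, OF \<kappa>(1)]
    unfolding a l by blast+
  thus "\<forall>\<^sub>F n in sequentially. N (\<lambda>x. L n f x - A f x) < ennreal r"
  proof eventually_elim
    case (elim n)
    interpret Ln: positive_bounded_operator \<rho> "L n" by (rule L)
    have close: "\<bar>l0 n t - a0 t\<bar> < \<kappa>" "\<bar>l1 n t - a1 t\<bar> < \<kappa>" "\<bar>l2 n t - a2 t\<bar> < \<kappa>" for t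
      using elim by (auto simp: dist_real_def)
    have reps: "AE t in lborel. A (\<lambda>x. 1) t = a0 t" "AE t in lborel. A cos t = a1 t"
      "AE t in lborel. A sin t = a2 t" "AE t in lborel. L n (\<lambda>x. 1) t = l0 n t"
      "AE t in lborel. L n cos t = l1 n t" "AE t in lborel. L n sin t = l2 n t"
      using lim unfolding tendsto_C_2pi_def a l by (auto intro: AE_C_rep)
    have "AE t in lborel. \<bar>L n f t - A f t\<bar> \<le> \<eta>"
      using Ln.korovkin_kernel_estimate[OF f C(2)] A.korovkin_kernel_estimate[OF f C(2)] reps
    proof eventually_elim
      case (elim t)
      have a0t: "0 < a0 t" by (rule a0_pos)
      have sq_t: "(a0 t)\<^sup>2 = (a1 t)\<^sup>2 + (a2 t)\<^sup>2"
        using sq unfolding a by blast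
      have "(a1 t / a0 t)\<^sup>2 + (a2 t / a0 t)\<^sup>2 = ((a1 t)\<^sup>2 + (a2 t)\<^sup>2) / (a0 t)\<^sup>2"
        by (simp only: power_divide add_divide_distrib)
      also have "\<dots> = 1"
        using a0t unfolding sq_t[symmetric] by simp
      finally obtain x where x: "a1 t / a0 t = cos x" "a2 t / a0 t = sin x"
        using sincos_total_2pi by metis
      have a12: "a1 t = cos x * a0 t" "a2 t = sin x * a0 t"
        using x a0t by (auto simp: field_simps)
      have "cos x * a1 t + sin x * a2 t = ((cos x)\<^sup>2 + (sin x)\<^sup>2) * a0 t"
        unfolding a12 by (simp only: power2_eq_square distrib_right mult.assoc)
      hence cs: "cos x * a1 t + sin x * a2 t = a0 t"
        by simp
      have "a0 t - cos x * a1 t - sin x * a2 t = 0"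
        using cs by simp
      hence e2: "\<bar>A f t - f x * a0 t\<bar> \<le> \<epsilon> * a0 t"
        using elim(2)[rule_format, of x] elim(3-5) by simp
      have e1: "\<bar>L n f t - f x * l0 n t\<bar> \<le> \<epsilon> * l0 n t + C * (l0 n t - cos x * l1 n t - sin x * l2 n t)"
        using elim(1)[rule_format, of x] elim(6-8) by simp
      have "\<bar>cos x * (l1 n t - a1 t)\<bar> \<le> 1 * \<kappa>" "\<bar>sin x * (l2 n t - a2 t)\<bar> \<le> 1 * \<kappa>"
        unfolding abs_mult using close[of t] by (intro mult_mono; simp)+
      \<comment> \<open>Subtracting the identity \<open>cs\<close> for \<open>A\<close> leaves only
        deviations of the three test functions, each at most \<open>\<kappa>\<close>.\<close>
      moreover have "l0 n t - cos x * l1 n t - sin x * l2 n t =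
          (l0 n t - a0 t) - cos x * (l1 n t - a1 t) - sin x * (l2 n t - a2 t)"
        using cs by (simp add: algebra_simps)
      ultimately have "l0 n t - cos x * l1 n t - sin x * l2 n t \<le> 3 * \<kappa>"
        using close(1)[of t] by linarith
      hence t1: "C * (l0 n t - cos x * l1 n t - sin x * l2 n t) \<le> C * (3 * \<kappa>)"
        using C(1) by (rule mult_left_mono)
      have "l0 n t + a0 t \<le> 2 * M + 1"
        using M(2)[of t] close(1)[of t] \<kappa>(2) by linarith
      hence t2: "\<epsilon> * (l0 n t + a0 t) \<le> \<epsilon> * (2 * M + 1)"
        using \<epsilon>(1) by (intro mult_left_mono) auto
      have t3: "\<bar>f x * (l0 n t - a0 t)\<bar> \<le> B * \<kappa>"
        unfolding abs_mult using B(2)[of x] close(1)[of t] B(1) by (intro mult_mono) auto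
      have "\<bar>L n f t - A f t\<bar> \<le> \<bar>L n f t - f x * l0 n t\<bar> + \<bar>f x * (l0 n t - a0 t)\<bar> + \<bar>A f t - f x * a0 t\<bar>"
        by (simp add: algebra_simps)
      also have "\<dots> \<le> \<epsilon> * (l0 n t + a0 t) + C * (l0 n t - cos x * l1 n t - sin x * l2 n t) + B * \<kappa>"
        using e1 e2 t3 by (simp add: algebra_simps)
      also have "\<dots> \<le> \<epsilon> * (2 * M + 1) + \<kappa> * (3 * C + B)"
        using t1 t2 by (simp add: algebra_simps)
      also have "\<dots> \<le> \<eta>"
        using \<epsilon>(2) \<kappa>' by simp
      finally show ?case .
    qed
    hence "N (\<lambda>x. L n f x - A f x) \<le> ennreal \<eta> * N (\<lambda>x. 1)"
      using XS_2pi_measurable(2)[OF Ln.T_in[OF C_2pi_in_XS_2pi[OF f]]]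
        XS_2pi_measurable(2)[OF A.T_in[OF C_2pi_in_XS_2pi[OF f]]] \<eta>(1)
      by (intro norm_le_const AE_Mpi_I) auto
    also note \<eta>(2)
    finally show ?case .
  qed
qed

text \<open>The usual three-term argument: \<open>f\<close> is replaced by a nearby continuous
  periodic \<open>h\<close>, at a cost controlled by the uniform bound of the \<open>L n\<close> and
  the bound of \<open>A\<close>.\<close>

lemma norm_tendsto_0_if_tendsto_0_on_C_2pi:
  fixes L :: "nat \<Rightarrow> (real \<Rightarrow> real) \<Rightarrow> real \<Rightarrow> real"
  assumes L: "\<And>n. positive_bounded_operator \<rho> (L n)" and A: "positive_bounded_operator \<rho> A"
    and bdd: "(SUP n. operator_norm \<rho> (L n)) < \<infinity>"
    and lim: "\<And>h. h \<in> C_2pi \<Longrightarrow> (\<lambda>n. N (\<lambda>x. L n h x - A h x)) \<longlonglongrightarrow> 0"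
    and f: "f \<in> XS_2pi \<rho>"
  shows "(\<lambda>n. N (\<lambda>x. L n f x - A f x)) \<longlonglongrightarrow> 0"
proof (rule tendsto_zero_ennreal)
  fix r :: real assume "0 < r"
  interpret A: positive_bounded_operator \<rho> A by (rule A)
  obtain KL where KL: "(SUP n. operator_norm \<rho> (L n)) = ennreal KL" "KL \<ge> 0"
    using bdd by (cases "SUP n. operator_norm \<rho> (L n)" rule: ennreal_cases) auto
  obtain KA where KA: "KA \<ge> 0" "\<And>f. f \<in> XS_2pi \<rho> \<Longrightarrow> N (A f) \<le> ennreal KA * N f"
    using A.T_norm_bound by blast
  \<comment> \<open>Both \<open>KL * e\<close> and \<open>KA * e\<close> are then at most
    \<open>r / 3\<close>; the added \<open>1\<close> excludes division by zero.\<close>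
  define e where "e = r / (3 * (KL + KA + 1))"
  have pos: "KL + KA + 1 > 0" using KL(2) KA(1) by simp
  have "r / (3 * z) * z = r / 3" if "z > 0" for z
    using that by simp
  from this[OF pos] have e: "e > 0" "e * (KL + KA + 1) = r / 3"
    using \<open>0 < r\<close> pos by (auto simp only: e_def intro!: divide_pos_pos mult_pos_pos)
  have Ke: "K * e \<le> r / 3" if "K \<le> KL + KA + 1" for K
    using mult_right_mono[OF that, of e] e by (simp add: mult.commute)
  obtain h where h: "h \<in> C_2pi" "N (\<lambda>x. f x - h x) < ennreal e"
    using C_2pi_dense[OF f e(1)] by blast
  have h_in: "h \<in> XS_2pi \<rho>"
    by (rule C_2pi_in_XS_2pi[OF h(1)])
  have fh: "(\<lambda>x. f x - h x) \<in> XS_2pi \<rho>"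
    by (rule XS_2pi_diff[OF f h_in])
  have "ennreal KA * N (\<lambda>x. f x - h x) \<le> ennreal KA * ennreal e"
    using h(2) by (intro mult_left_mono) auto
  also have "\<dots> = ennreal (KA * e)"
    using KA(1) e(1) by (simp add: ennreal_mult)
  also have "\<dots> \<le> ennreal (r / 3)"
    using KL(2) by (intro ennreal_leI Ke) auto
  finally have A_fh: "N (\<lambda>x. A f x - A h x) \<le> ennreal (r / 3)"
    using KA(2)[OF fh] A.norm_T_diff[OF f h_in] by (simp add: order_trans)
  have L_fh: "N (\<lambda>x. L n f x - L n h x) \<le> ennreal (r / 3)" for n
  proof -
    interpret Ln: positive_bounded_operator \<rho> "L n" by (rule L)
    have "N (\<lambda>x. L n f x - L n h x) \<le> operator_norm \<rho> (L n) * N (\<lambda>x. f x - h x)"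
      unfolding Ln.norm_T_diff[OF f h_in] by (rule Ln.norm_T_le_operator_norm[OF fh])
    also have "\<dots> \<le> ennreal KL * ennreal e"
      using h(2) unfolding KL(1)[symmetric] by (intro mult_mono SUP_upper) auto
    also have "\<dots> = ennreal (KL * e)"
      using KL(2) e(1) by (simp add: ennreal_mult)
    also have "\<dots> \<le> ennreal (r / 3)"
      using KA(1) by (intro ennreal_leI Ke) auto
    finally show ?thesis .
  qed
  have "\<forall>\<^sub>F n in sequentially. N (\<lambda>x. L n h x - A h x) < ennreal (r / 3)"
    using lim[OF h(1)] \<open>0 < r\<close> by (intro order_tendstoD(2)) auto
  thus "\<forall>\<^sub>F n in sequentially. N (\<lambda>x. L n f x - A f x) < ennreal r"
  proof eventually_elim
    case (elim n)
    interpret Ln: positive_bounded_operator \<rho> "L n" by (rule L)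
    note meas = Ln.T_in[OF f, THEN XS_2pi_measurable(2)] Ln.T_in[OF h_in, THEN XS_2pi_measurable(2)]
      A.T_in[OF f, THEN XS_2pi_measurable(2)] A.T_in[OF h_in, THEN XS_2pi_measurable(2)]
    have "N (\<lambda>x. L n f x - A f x) \<le> N (\<lambda>x. L n f x - L n h x) + N (\<lambda>x. L n h x - A f x)"
      by (intro norm_triangle meas)
    also have "\<dots> \<le> N (\<lambda>x. L n f x - L n h x) + (N (\<lambda>x. L n h x - A h x) + N (\<lambda>x. A h x - A f x))"
      by (intro add_left_mono norm_triangle meas)
    also have "\<dots> \<le> ennreal (r / 3) + (N (\<lambda>x. L n h x - A h x) + ennreal (r / 3))"
      using L_fh[of n] A_fh by (intro add_mono) (auto simp: norm_minus_commute[of "A h"])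
    \<comment> \<open>Only the middle term is strictly below its share. Collecting the finite
      constants lets them be cancelled in \<open>ennreal\<close>.\<close>
    also have "\<dots> = ennreal (r / 3 + r / 3) + N (\<lambda>x. L n h x - A h x)"
      using \<open>0 < r\<close> by (subst ennreal_plus) (auto simp: ac_simps)
    also have "\<dots> < ennreal (r / 3 + r / 3) + ennreal (r / 3)"
      using elim by (subst ennreal_add_left_cancel_less) auto
    also have "\<dots> = ennreal r"
      using \<open>0 < r\<close> by (simp flip: ennreal_plus)
    finally show ?case .
  qed
qed

lemma norm_bounded_if_tendsto_0:
  fixes L :: "nat \<Rightarrow> (real \<Rightarrow> real) \<Rightarrow> real \<Rightarrow> real"
  assumes L: "\<And>n. L n f \<in> XS_2pi \<rho>" and A: "A f \<in> XS_2pi \<rho>"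
    and lim: "(\<lambda>n. N (\<lambda>x. L n f x - A f x)) \<longlonglongrightarrow> 0"
  shows "\<exists>K<\<infinity>. \<forall>n. N (L n f) \<le> K"
proof -
  have "\<forall>\<^sub>F n in sequentially. N (\<lambda>x. L n f x - A f x) < 1"
    using lim by (intro order_tendstoD(2)) auto
  then obtain n0 where n0: "\<And>n. n \<ge> n0 \<Longrightarrow> N (\<lambda>x. L n f x - A f x) < 1"
    by (auto simp: eventually_sequentially)
  \<comment> \<open>A sum in place of a maximum bounds the initial terms and also covers
    \<open>n0 = 0\<close>.\<close>
  define K where "K = (\<Sum>n<n0. N (L n f)) + (1 + N (A f))"
  have "K < \<infinity>"
    using XS_2pi_finite[OF L] XS_2pi_finite[OF A] by (auto simp: K_def)
  moreover have "N (L n f) \<le> K" for n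
  proof (cases "n < n0")
    case True
    have "N (L n f) \<le> (\<Sum>n<n0. N (L n f))"
      using True by (intro member_le_sum) auto
    thus ?thesis
      by (auto simp: K_def intro: add_increasing2)
  next
    case False
    have "N (\<lambda>x. (L n f x - A f x) + A f x) \<le> N (\<lambda>x. L n f x - A f x) + N (A f)"
      using XS_2pi_measurable(2)[OF L] XS_2pi_measurable(2)[OF A] by (intro norm_add) auto
    also have "\<dots> \<le> 1 + N (A f)"
      using n0[of n] False by (intro add_right_mono) auto
    finally show ?thesis
      by (auto simp: K_def intro: add_increasing)
  qed
  ultimately show ?thesis by blast
qed

end

section \<open>The equivalence of convergence and uniform boundedness\<close>

theorem theorem12:
  fixes \<rho> :: "(real \<Rightarrow> real) \<Rightarrow> ennreal"
    and L :: "nat \<Rightarrow> (real \<Rightarrow> real) \<Rightarrow> (real \<Rightarrow> real)"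
    and A :: "(real \<Rightarrow> real) \<Rightarrow> (real \<Rightarrow> real)"
    and h0 h1 h2 :: "real \<Rightarrow> real"
  assumes "function_norm interval_measure_pi \<rho>"
    and "(\<lambda>x. 1) \<in> bfs_ac interval_measure_pi \<rho>"
    and "\<And>n. bounded_operator \<rho> (L n)" and "\<And>n. positive_operator \<rho> (L n)"
    and "bounded_operator \<rho> A" and "positive_operator \<rho> A"
    and "h0 = (\<lambda>x. 1)" and "h1 = (\<lambda>x. cos x)" and "h2 = (\<lambda>x. sin x)"
    and "\<And>t. (C_rep (A h0) t)\<^sup>2 = (C_rep (A h1) t)\<^sup>2 + (C_rep (A h2) t)\<^sup>2"
    and "\<And>t. t \<in> {-pi..pi} \<Longrightarrow> C_rep (A h0) t > 0"
    and "\<And>g. g \<in> {h0, h1, h2} \<Longrightarrow> tendsto_C_2pi (\<lambda>n. L n g) (A g)"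
  shows "(\<forall>f \<in> XS_2pi \<rho>. (\<lambda>n. bfs_norm \<rho> (\<lambda>x. L n f x - A f x)) \<longlonglongrightarrow> 0)
           \<longleftrightarrow> (SUP n. operator_norm \<rho> (L n)) < \<infinity>"
proof -
  interpret pi_ac_function_norm \<rho>
    using assms(1,2) by unfold_locales
  have L: "positive_bounded_operator \<rho> (L n)" for n
    using assms(3,4) by unfold_locales
  interpret A: positive_bounded_operator \<rho> A
    using assms(5,6) by unfold_locales
  have A: "positive_bounded_operator \<rho> A" ..
  show ?thesis
  proof
    assume lim: "\<forall>f \<in> XS_2pi \<rho>. (\<lambda>n. N (\<lambda>x. L n f x - A f x)) \<longlonglongrightarrow> 0"
    show "(SUP n. operator_norm \<rho> (L n)) < \<infinity>"
    proof (rule positive_uniform_boundedness[OF L])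
      fix f assume f: "f \<in> XS_2pi \<rho>"
      show "\<exists>K<\<infinity>. \<forall>n. N (L n f) \<le> K"
        using f lim by (intro norm_bounded_if_tendsto_0[of L f A] A.T_in
            positive_bounded_operator.T_in[OF L]) auto
    qed
  next
    assume bdd: "(SUP n. operator_norm \<rho> (L n)) < \<infinity>"
    have lim_C: "(\<lambda>n. N (\<lambda>x. L n h x - A h x)) \<longlonglongrightarrow> 0" if "h \<in> C_2pi" for h
      using korovkin_C_2pi[OF L A _ _ _ _ _ that] assms(10-12) unfolding assms(7-9) by simp
    show "\<forall>f \<in> XS_2pi \<rho>. (\<lambda>n. N (\<lambda>x. L n f x - A f x)) \<longlonglongrightarrow> 0"
      using norm_tendsto_0_if_tendsto_0_on_C_2pi[OF L A bdd lim_C] by blast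
  qed
qed

end
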